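(* Let $\mathcal{X}=c_0$ be the complex Banach space of null sequences, with open unit ball $B$, let $B^{**}$ be the open unit ball of $\ell^\infty=\mathcal{X}^{**}$, and let $\mathcal{M}_0$ be the fiber over $0$ of the spectrum $\mathcal{M}$ of $H^\infty(B)$. Then there is an analytic injection $S:B^{**}\to\mathcal{M}_0$ which is an isometry from the Gleason metric of $B^{**}$ to the Gleason metric of $\mathcal{M}$.
   Context: For the open unit ball $D$ of a complex Banach space, $H^\infty(D)$ is the algebra of bounded analytic functions on $D$ with the supremum norm. The spectrum $\mathcal{M}$ of $H^\infty(B)$ is the set of nonzero complex-valued homomorphisms of $H^\infty(B)$; write $f(\varphi)=\varphi(f)$. Regard $\mathcal{X}^*=\ell^1\subset H^\infty(B)$ by restriction to $B$; $\mathcal{M}_0=\{\varphi\in\mathcal{M}:\varphi(L)=0\ \forall L\in\mathcal{X}^*\}$. The Gleason metric on $\mathcal{M}$ is $\rho(\varphi,\psi)=\sup\{|f(\varphi)-f(\psi)|: f\in H^\infty(B),\ \|f\|\le1\}$; the Gleason metric on $B^{**}$ is $\rho(z,w)=\sup\{|f(z)-f(w)|: f\in H^\infty(B^{**}),\ \|f\|\le1\}$. A map $S:B^{**}\to\mathcal{M}$ is analytic if $f\circ S$ is analytic on $B^{**}$ for all $f\in H^\infty(B)$. *)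

theory Defs
  imports "HOL-Analysis.Analysis"
begin

section \<open>Complex Banach spaces\<close>

class scaleC =
  fixes scaleC :: "complex \<Rightarrow> 'a \<Rightarrow> 'a"  (infixr \<open>*\<^sub>C\<close> 75)

class complex_normed_vector = scaleC + real_normed_vector +
  assumes scaleC_add_right: "a *\<^sub>C (x + y) = a *\<^sub>C x + a *\<^sub>C y"
    and scaleC_add_left: "(a + b) *\<^sub>C x = a *\<^sub>C x + b *\<^sub>C x"
    and scaleC_scaleC: "a *\<^sub>C b *\<^sub>C x = (a * b) *\<^sub>C x"
    and scaleC_of_real: "complex_of_real r *\<^sub>C x = r *\<^sub>R x"
    and norm_scaleC: "norm (a *\<^sub>C x) = cmod a * norm x"

class complex_banach = complex_normed_vector + complete_space

instantiation complex :: complex_banach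
begin

definition scaleC_complex :: "complex \<Rightarrow> complex \<Rightarrow> complex"
  where "scaleC_complex a x = a * x"

instance
  by standard (auto simp: scaleC_complex_def algebra_simps norm_mult scaleR_conv_of_real)

end

lemma bounded_linear_scaleC: "bounded_linear (\<lambda>x :: 'a :: complex_normed_vector. a *\<^sub>C x)"
proof
  fix x y :: 'a and r :: real
  show "a *\<^sub>C (x + y) = a *\<^sub>C x + a *\<^sub>C y"
    by (rule scaleC_add_right)
  show "a *\<^sub>C (r *\<^sub>R x) = r *\<^sub>R (a *\<^sub>C x)"
    by (simp add: scaleC_of_real [symmetric] scaleC_scaleC mult.commute)
  show "\<exists>K. \<forall>x :: 'a. norm (a *\<^sub>C x) \<le> norm x * K"
    by (rule exI [of _ "cmod a"]) (simp add: norm_scaleC mult.commute)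
qed


section \<open>The spaces of bounded sequences and of null sequences\<close>

text \<open>
  The library proves completeness of \<open>'a \<Rightarrow>\<^sub>C 'b\<close> only for metric spaces \<open>'a\<close>, so \<open>nat\<close> is
  given a metric inducing its (discrete) topology.
\<close>

instantiation nat :: metric_space
begin

definition dist_nat :: "nat \<Rightarrow> nat \<Rightarrow> real"
  where "dist_nat m n = \<bar>real m - real n\<bar>"

definition uniformity_nat :: "(nat \<times> nat) filter"
  where "uniformity_nat = (INF e\<in>{0 <..}. principal {(x, y). dist x y < e})"

instance
proof
  show "uniformity = (INF e\<in>{0 <..}. principal {(x :: nat, y). dist x y < e})"
    by (rule uniformity_nat_def)
  have eq: "x = y" if "\<bar>real x - real y\<bar> < 1" for x y
    using that by linarith
  have "\<forall>\<^sub>F (x', y) in uniformity. x' = x \<longrightarrow> y \<in> U" if "x \<in> U" for x and U :: "nat set"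
    unfolding uniformity_nat_def
    by (rule eventually_INF1 [of 1]) (use that in \<open>auto simp: dist_nat_def eventually_principal dest: eq\<close>)
  then show "open U = (\<forall>x\<in>U. \<forall>\<^sub>F (x', y) in uniformity. x' = x \<longrightarrow> y \<in> U)" for U :: "nat set"
    by (simp add: open_discrete)
qed (auto simp: dist_nat_def)

end

text \<open>
  Since \<open>nat\<close> is discrete, \<open>nat \<Rightarrow>\<^sub>C complex\<close> is the space of all bounded
  complex sequences with the supremum norm.
\<close>

type_synonym linf = "nat \<Rightarrow>\<^sub>C complex"

instantiation bcontfun :: (topological_space, complex_normed_vector) complex_normed_vector
begin

definition scaleC_bcontfun :: "complex \<Rightarrow> ('a \<Rightarrow>\<^sub>C 'b) \<Rightarrow> 'a \<Rightarrow>\<^sub>C 'b"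
  where "scaleC_bcontfun a f = Bcontfun (\<lambda>x. a *\<^sub>C apply_bcontfun f x)"

lemma apply_bcontfun_scaleC [simp]:
  "apply_bcontfun (a *\<^sub>C f) = (\<lambda>x. a *\<^sub>C apply_bcontfun f x)" for f :: "'a \<Rightarrow>\<^sub>C 'b"
proof -
  have "(\<lambda>x. a *\<^sub>C apply_bcontfun f x) \<in> bcontfun"
  proof (rule bcontfun_normI)
    show "continuous_on UNIV (\<lambda>x. a *\<^sub>C apply_bcontfun f x)"
      by (rule bounded_linear.continuous_on [OF bounded_linear_scaleC]) simp
    show "norm (a *\<^sub>C apply_bcontfun f x) \<le> cmod a * norm f" for x
      by (simp add: norm_scaleC mult_left_mono norm_bounded)
  qed
  then show ?thesis
    by (simp add: scaleC_bcontfun_def Bcontfun_inverse)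
qed

instance
proof
  fix a b :: complex and r :: real and f g :: "'a \<Rightarrow>\<^sub>C 'b"
  show "a *\<^sub>C (f + g) = a *\<^sub>C f + a *\<^sub>C g"
    by (rule bcontfun_eqI) (simp add: scaleC_add_right)
  show "(a + b) *\<^sub>C f = a *\<^sub>C f + b *\<^sub>C f"
    by (rule bcontfun_eqI) (simp add: scaleC_add_left)
  show *: "a *\<^sub>C b *\<^sub>C f = (a * b) *\<^sub>C f" for a b and f :: "'a \<Rightarrow>\<^sub>C 'b"
    by (rule bcontfun_eqI) (simp add: scaleC_scaleC)
  show **: "complex_of_real r *\<^sub>C f = r *\<^sub>R f" for r and f :: "'a \<Rightarrow>\<^sub>C 'b"
    by (rule bcontfun_eqI) (simp add: scaleC_of_real)
  have le: "norm (a *\<^sub>C f) \<le> cmod a * norm f" for a and f :: "'a \<Rightarrow>\<^sub>C 'b"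
    by (rule norm_bound) (simp add: norm_scaleC mult_left_mono norm_bounded)
  show "norm (a *\<^sub>C f) = cmod a * norm f"
  proof (cases "a = 0")
    case True
    then show ?thesis
      using le [of 0 f] by simp
  next
    case False
    have "f = inverse a *\<^sub>C a *\<^sub>C f"
      using False ** [of 1 f] by (simp add: *)
    then have "norm f \<le> inverse (cmod a) * norm (a *\<^sub>C f)"
      using le [of "inverse a" "a *\<^sub>C f"] by (simp add: norm_inverse)
    then have "cmod a * norm f \<le> norm (a *\<^sub>C f)"
      using False by (simp add: field_simps)
    with le [of a f] show ?thesis
      by simp
  qed
qed

end

instance bcontfun :: (metric_space, complex_banach) complex_banach ..

typedef c0 = "{x :: linf. apply_bcontfun x \<longlonglongrightarrow> 0}"
  morphisms linf_of_c0 c0_of_linf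
  by (rule exI [of _ 0]) (simp add: zero_bcontfun.rep_eq)

setup_lifting type_definition_c0

instantiation c0 :: complex_normed_vector
begin

lift_definition zero_c0 :: c0 is 0 by (simp add: zero_bcontfun.rep_eq)

lift_definition plus_c0 :: "c0 \<Rightarrow> c0 \<Rightarrow> c0" is "(+)"
  by (drule (1) tendsto_add) (simp add: plus_bcontfun.rep_eq)

lift_definition minus_c0 :: "c0 \<Rightarrow> c0 \<Rightarrow> c0" is "(-)"
  by (drule (1) tendsto_diff) (simp add: minus_bcontfun.rep_eq)

lift_definition uminus_c0 :: "c0 \<Rightarrow> c0" is uminus
  by (drule tendsto_minus) (simp add: uminus_bcontfun.rep_eq)

lift_definition scaleR_c0 :: "real \<Rightarrow> c0 \<Rightarrow> c0" is scaleR
  by (drule tendsto_scaleR [OF tendsto_const]) (simp add: scaleR_bcontfun.rep_eq)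

lift_definition scaleC_c0 :: "complex \<Rightarrow> c0 \<Rightarrow> c0" is scaleC
  using tendsto_mult_right_zero by (simp add: scaleC_complex_def)

lift_definition norm_c0 :: "c0 \<Rightarrow> real" is norm .

lift_definition dist_c0 :: "c0 \<Rightarrow> c0 \<Rightarrow> real" is dist .

lift_definition sgn_c0 :: "c0 \<Rightarrow> c0" is sgn
  by (drule tendsto_scaleR [OF tendsto_const]) (simp add: sgn_div_norm scaleR_bcontfun.rep_eq)

definition uniformity_c0 :: "(c0 \<times> c0) filter"
  where "uniformity_c0 = (INF e\<in>{0 <..}. principal {(x, y). dist x y < e})"

definition open_c0 :: "c0 set \<Rightarrow> bool"
  where "open_c0 U = (\<forall>x\<in>U. \<forall>\<^sub>F (x', y) in uniformity. x' = x \<longrightarrow> y \<in> U)"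

instance
proof
  fix a b :: complex and r s :: real and x y z :: c0
  show "x + y + z = x + (y + z)" by transfer (simp add: algebra_simps)
  show "x + y = y + x" by transfer (simp add: algebra_simps)
  show "0 + x = x" by transfer simp
  show "- x + x = 0" by transfer simp
  show "x - y = x + - y" by transfer simp
  show "r *\<^sub>R (x + y) = r *\<^sub>R x + r *\<^sub>R y" by transfer (simp add: algebra_simps)
  show "(r + s) *\<^sub>R x = r *\<^sub>R x + s *\<^sub>R x" by transfer (simp add: algebra_simps)
  show "r *\<^sub>R s *\<^sub>R x = (r * s) *\<^sub>R x" by transfer simp
  show "1 *\<^sub>R x = x" by transfer simp
  show "dist x y = norm (x - y)" by transfer (rule dist_norm)
  show "sgn x = inverse (norm x) *\<^sub>R x" by transfer (rule sgn_div_norm)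
  show "uniformity = (INF e\<in>{0 <..}. principal {(x :: c0, y). dist x y < e})"
    by (rule uniformity_c0_def)
  show "open U = (\<forall>x\<in>U. \<forall>\<^sub>F (x', y) in uniformity. x' = x \<longrightarrow> y \<in> U)" for U :: "c0 set"
    by (rule open_c0_def)
  show "(norm x = 0) = (x = 0)" by transfer simp
  show "norm (x + y) \<le> norm x + norm y" by transfer (rule norm_triangle_ineq)
  show "norm (r *\<^sub>R x) = \<bar>r\<bar> * norm x" by transfer simp
  show "a *\<^sub>C (x + y) = a *\<^sub>C x + a *\<^sub>C y" by transfer (rule scaleC_add_right)
  show "(a + b) *\<^sub>C x = a *\<^sub>C x + b *\<^sub>C x" by transfer (rule scaleC_add_left)
  show "a *\<^sub>C b *\<^sub>C x = (a * b) *\<^sub>C x" by transfer (rule scaleC_scaleC)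
  show "complex_of_real r *\<^sub>C x = r *\<^sub>R x" by transfer (rule scaleC_of_real)
  show "norm (a *\<^sub>C x) = cmod a * norm x" by transfer (rule norm_scaleC)
qed

end

lemma closed_null_sequences: "closed {x :: linf. apply_bcontfun x \<longlonglongrightarrow> 0}"
  unfolding closed_sequential_limits
proof safe
  fix X :: "nat \<Rightarrow> linf" and l
  assume null: "\<forall>n. X n \<in> {x. apply_bcontfun x \<longlonglongrightarrow> 0}" and lim: "X \<longlonglongrightarrow> l"
  have "uniform_limit UNIV (\<lambda>n. apply_bcontfun (X n)) (apply_bcontfun l) sequentially"
    by (rule tendsto_bcontfun_uniform_limit [OF lim])
  then show "apply_bcontfun l \<longlonglongrightarrow> 0"
    by (rule swap_uniform_limit' [where f = "\<lambda>n. apply_bcontfun (X n)" and g = "\<lambda>_. 0", rotated 2])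
      (use null in auto)
qed

instance c0 :: complex_banach
proof
  fix X :: "nat \<Rightarrow> c0"
  assume "Cauchy X"
  then have "Cauchy (\<lambda>n. linf_of_c0 (X n))"
    unfolding Cauchy_def dist_c0.rep_eq .
  then obtain l where l: "(\<lambda>n. linf_of_c0 (X n)) \<longlonglongrightarrow> l"
    by (auto dest!: Cauchy_convergent simp: convergent_def)
  then have "l \<in> {x. apply_bcontfun x \<longlonglongrightarrow> 0}"
    by (rule closed_sequentially [OF closed_null_sequences, rotated]) (rule linf_of_c0)
  then have "linf_of_c0 (c0_of_linf l) = l"
    by (rule c0_of_linf_inverse)
  with l have "X \<longlonglongrightarrow> c0_of_linf l"
    unfolding LIMSEQ_def dist_c0.rep_eq by simp
  then show "convergent X"
    by (rule convergentI)
qed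


section \<open>Bounded analytic functions\<close>

definition complex_linear ::
  "('a :: complex_normed_vector \<Rightarrow> 'b :: complex_normed_vector) \<Rightarrow> bool"
  where "complex_linear L \<longleftrightarrow>
    (\<forall>x y. L (x + y) = L x + L y) \<and> (\<forall>a x. L (a *\<^sub>C x) = a *\<^sub>C L x)"

text \<open>
  Analyticity on an open set is complex Frechet differentiability at every point: the real
  Frechet derivative exists (and is bounded, by \<^const>\<open>has_derivative\<close>) and is complex linear.
\<close>

definition complex_analytic_on ::
  "('a :: complex_banach \<Rightarrow> 'b :: complex_banach) \<Rightarrow> 'a set \<Rightarrow> bool"
  where "complex_analytic_on f U \<longleftrightarrow>
    (\<forall>x\<in>U. \<exists>f'. (f has_derivative f') (at x) \<and> complex_linear f')"

definition complex_dual :: "('a :: complex_banach \<Rightarrow> complex) set"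
  where "complex_dual = {L. bounded_linear L \<and> complex_linear L}"

text \<open>
  Functions on \<open>D\<close> are represented as total functions that are \<^const>\<open>undefined\<close> outside \<open>D\<close>,
  so that equality in \<open>Hinf D\<close> is equality on \<open>D\<close>. The set \<open>D\<close> is meant to be open.
\<close>

definition Hinf :: "'a :: complex_banach set \<Rightarrow> ('a \<Rightarrow> complex) set"
  where "Hinf D = {f \<in> extensional D. complex_analytic_on f D \<and> bounded (f ` D)}"

definition Hinf_norm :: "'a :: complex_banach set \<Rightarrow> ('a \<Rightarrow> complex) \<Rightarrow> real"
  where "Hinf_norm D f = (SUP x\<in>D. cmod (f x))"


section \<open>The spectrum, its fiber over the origin, and the Gleason metrics\<close>

text \<open>Again, homomorphisms are \<^const>\<open>undefined\<close> outside \<open>Hinf D\<close>.\<close>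

definition Hinf_spectrum :: "'a :: complex_banach set \<Rightarrow> (('a \<Rightarrow> complex) \<Rightarrow> complex) set"
  where "Hinf_spectrum D = {\<phi> \<in> extensional (Hinf D).
    (\<forall>f\<in>Hinf D. \<forall>g\<in>Hinf D. \<phi> (\<lambda>x\<in>D. f x + g x) = \<phi> f + \<phi> g) \<and>
    (\<forall>c. \<forall>f\<in>Hinf D. \<phi> (\<lambda>x\<in>D. c * f x) = c * \<phi> f) \<and>
    (\<forall>f\<in>Hinf D. \<forall>g\<in>Hinf D. \<phi> (\<lambda>x\<in>D. f x * g x) = \<phi> f * \<phi> g) \<and>
    (\<exists>f\<in>Hinf D. \<phi> f \<noteq> 0)}"

definition spectrum_fiber0 :: "'a :: complex_banach set \<Rightarrow> (('a \<Rightarrow> complex) \<Rightarrow> complex) set"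
  where "spectrum_fiber0 D = {\<phi> \<in> Hinf_spectrum D. \<forall>L\<in>complex_dual. \<phi> (restrict L D) = 0}"

definition gleason_spectrum ::
  "'a :: complex_banach set \<Rightarrow> (('a \<Rightarrow> complex) \<Rightarrow> complex) \<Rightarrow> (('a \<Rightarrow> complex) \<Rightarrow> complex) \<Rightarrow> real"
  where "gleason_spectrum D \<phi> \<psi> = (SUP f\<in>{f \<in> Hinf D. Hinf_norm D f \<le> 1}. cmod (\<phi> f - \<psi> f))"

definition gleason_domain :: "'a :: complex_banach set \<Rightarrow> 'a \<Rightarrow> 'a \<Rightarrow> real"
  where "gleason_domain D z w = (SUP f\<in>{f \<in> Hinf D. Hinf_norm D f \<le> 1}. cmod (f z - f w))"

definition analytic_into_spectrum ::
  "'b :: complex_banach set \<Rightarrow> 'a :: complex_banach set \<Rightarrow> ('b \<Rightarrow> ('a \<Rightarrow> complex) \<Rightarrow> complex) \<Rightarrow> bool"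
  where "analytic_into_spectrum U D S \<longleftrightarrow>
    (\<forall>f\<in>Hinf D. complex_analytic_on (\<lambda>z. S z f) U)"

end

theory Submission
  imports Defs "HOL-Complex_Analysis.Riemann_Mapping"
begin

text \<open>
  Split the coordinates of null sequences into disjoint blocks indexed by \<open>n\<close>, choose radii \<open>r\<^sub>n\<close> that
  tend rapidly to \<open>1\<close>, and let \<open>\<sigma>\<^sub>n z\<close> carry the entries \<open>(z\<^sub>j + r\<^sub>n) / (1 + r\<^sub>n z\<^sub>j)\<close>, \<open>j \<le> n\<close>, in the \<open>n\<close>-th
  block and \<open>0\<close> elsewhere. The \<open>\<sigma>\<^sub>n z\<close> tend weakly to \<open>0\<close>, so the limit \<open>S z f\<close> of \<open>f (\<sigma>\<^sub>n z)\<close> along a filter on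
  which all bounded sequences converge is a homomorphism in the fiber over \<open>0\<close>. It is analytic in \<open>z\<close>
  because bounded pointwise limits of analytic functions are analytic, and it does not increase
  Gleason distances because \<open>f \<circ> S\<close> is bounded by the norm of \<open>f\<close>.

  Conversely, the product over \<open>n \<ge> N\<close> of the factors \<open>(r\<^sub>n - x) / (1 - r\<^sub>n x)\<close>, with \<open>x\<close> the \<open>j\<close>-th
  coordinate of block \<open>n\<close>, lies in the unit ball of bounded analytic functions and takes at \<open>\<sigma>\<^sub>n z\<close> a value
  within \<open>2\<close> to the power \<open>-N\<close> of \<open>-z\<^sub>j\<close>. So \<open>S z\<close> and \<open>S w\<close> are at least as far apart as all pairs \<open>z\<^sub>j\<close>, \<open>w\<^sub>j\<close>
  are in the disc, and an analytic disc through \<open>z\<close> and \<open>w\<close> shows that these pairs determine the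
  Gleason distance of \<open>z\<close> and \<open>w\<close>.
\<close>

section \<open>Limits of bounded analytic functions\<close>

lemma has_derivative_quadratic:
  assumes "bounded_linear L" and "0 < s"
    and le: "\<And>h. norm h < s \<Longrightarrow> norm (F (x + h) - F x - L h) \<le> K * (norm h)\<^sup>2"
  shows "(F has_derivative L) (at x)"
proof (rule has_derivativeI_sandwich [where H = "\<lambda>y. K * norm (y - x)" and e = s])
  show "((\<lambda>y. K * norm (y - x)) \<longlongrightarrow> 0) (at x)"
    by (auto intro!: tendsto_eq_intros)
  show "norm (F y - F x - L (y - x)) / norm (y - x) \<le> K * norm (y - x)"
    if "y \<noteq> x" "dist y x < s" for y
    using le [of "y - x"] that by (simp add: dist_norm divide_le_eq power2_eq_square mult.assoc)
qed (use assms in auto)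

text \<open>Cauchy's inequality on circles of radius \<open>R / 4\<close> about points of the closed
  unit disc bounds the second derivative by \<open>2 * M / (R / 4)\<^sup>2\<close>, and Taylor's
  formula on that disc turns this into the remainder bound. Since \<open>R > 2\<close>, all these
  circles stay inside \<open>ball 0 R\<close>.\<close>

lemma holomorphic_second_order_bound:
  fixes \<phi> :: "complex \<Rightarrow> complex"
  assumes hol: "\<phi> holomorphic_on ball 0 R" and le: "\<And>z. z \<in> ball 0 R \<Longrightarrow> cmod (\<phi> z) \<le> M"
    and R: "2 < R"
  shows "cmod (\<phi> 1 - \<phi> 0 - deriv \<phi> 0) \<le> 32 * M / R\<^sup>2"
proof -
  have sub: "cball z (R / 4) \<subseteq> ball 0 R" if "cmod z \<le> 1" for z
  proof
    fix y assume "y \<in> cball z (R / 4)"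
    then show "y \<in> ball 0 R"
      using norm_triangle_ineq [of z "y - z"] that R by (auto simp: dist_norm norm_minus_commute)
  qed
  have "cmod ((deriv ^^ Suc 1) \<phi> z) \<le> 32 * M / R\<^sup>2" if "z \<in> cball 0 1" for z
  proof -
    have "cmod ((deriv ^^ 2) \<phi> z) \<le> fact 2 * M / (R / 4) ^ 2"
    proof (rule Cauchy_inequality)
      show "\<phi> holomorphic_on ball z (R / 4)"
        by (rule holomorphic_on_subset [OF hol]) (use sub [of z] that in force)
      show "continuous_on (cball z (R / 4)) \<phi>"
        using holomorphic_on_imp_continuous_on [OF hol] sub [of z] that continuous_on_subset by force
      show "cmod (\<phi> y) \<le> M" if "cmod (z - y) = R / 4" for y
        by (rule le, rule subsetD [OF sub [of z]]) (use that \<open>z \<in> cball 0 1\<close> in \<open>auto simp: dist_norm\<close>)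
    qed (use R in simp)
    then show ?thesis
      by (simp add: eval_nat_numeral field_simps)
  qed
  moreover have "((deriv ^^ i) \<phi> has_field_derivative (deriv ^^ Suc i) \<phi> z) (at z within cball 0 1)"
    if "z \<in> cball 0 1" for i z
  proof -
    have "(deriv ^^ i) \<phi> holomorphic_on ball 0 R"
      by (rule holomorphic_higher_deriv [OF hol]) simp
    then have "((deriv ^^ i) \<phi> has_field_derivative deriv ((deriv ^^ i) \<phi>) z) (at z)"
      by (rule holomorphic_derivI) (use that R in auto)
    then show ?thesis
      by (simp add: has_field_derivative_at_within)
  qed
  ultimately have "cmod ((deriv ^^ 0) \<phi> 1 - (\<Sum>i\<le>1. (deriv ^^ i) \<phi> 0 * (1 - 0) ^ i / fact i))
      \<le> 32 * M / R\<^sup>2 * cmod (1 - 0) ^ Suc 1 / fact 1"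
    by (intro complex_Taylor [where S = "cball 0 1"]) auto
  then show ?thesis
    by (simp add: algebra_simps)
qed

lemma bounded_linear_scaleC_left: "bounded_linear (\<lambda>a. a *\<^sub>C (x :: 'a :: complex_normed_vector))"
proof
  fix a b :: complex and r :: real
  show "(a + b) *\<^sub>C x = a *\<^sub>C x + b *\<^sub>C x"
    by (rule scaleC_add_left)
  show "(r *\<^sub>R a) *\<^sub>C x = r *\<^sub>R a *\<^sub>C x"
    using scaleC_scaleC [of "of_real r" a x] by (simp add: scaleC_of_real scaleR_conv_of_real)
  show "\<exists>K. \<forall>a. norm (a *\<^sub>C x) \<le> norm a * K"
    by (rule exI [of _ "norm x"]) (simp add: norm_scaleC)
qed

lemma scaleC_zero [simp]: "0 *\<^sub>C (x :: 'a :: complex_normed_vector) = 0"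
  and scaleC_one [simp]: "1 *\<^sub>C (x :: 'a :: complex_normed_vector) = x"
  and scaleC_zero_right [simp]: "a *\<^sub>C (0 :: 'a :: complex_normed_vector) = 0"
  using scaleC_of_real [of 0 x] scaleC_of_real [of 1 x] linear_simps(3) [OF bounded_linear_scaleC]
  by simp_all

text \<open>Restriction to a complex line reduces estimates on a Banach space to one complex
  variable.\<close>

lemma complex_analytic_on_slice:
  fixes f :: "'a :: complex_banach \<Rightarrow> complex"
  assumes "(f has_derivative f') (at (x + c *\<^sub>C h))" and "complex_linear f'"
  shows "((\<lambda>c. f (x + c *\<^sub>C h)) has_field_derivative f' h) (at c)"
proof -
  have "((\<lambda>c. x + c *\<^sub>C h) has_derivative (\<lambda>c. c *\<^sub>C h)) (at c)"
    using has_derivative_add [OF has_derivative_const bounded_linear_imp_has_derivative [OF bounded_linear_scaleC_left]]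
    by simp
  from has_derivative_compose [OF this assms(1)]
  have "((\<lambda>c. f (x + c *\<^sub>C h)) has_derivative (\<lambda>c. f' (c *\<^sub>C h))) (at c)" .
  moreover have "(\<lambda>c. f' (c *\<^sub>C h)) = (*) (f' h)"
    using assms(2) by (auto simp: complex_linear_def scaleC_complex_def mult.commute)
  ultimately show ?thesis
    by (simp add: has_field_derivative_def)
qed

text \<open>In direction \<open>h\<close> the slice of \<open>f\<close> is holomorphic on the disc
  of radius \<open>r / norm h\<close>, so the one-variable Cauchy estimates apply;
  \<open>norm h < r / 2\<close> makes that radius exceed 2. The constants depend on \<open>M\<close>
  and \<open>r\<close> only, so a whole family of functions bounded by \<open>M\<close> shares
  them.\<close>

lemma
  fixes f :: "'a :: complex_banach \<Rightarrow> complex"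
  assumes f: "complex_analytic_on f (ball x r)" and le: "\<And>y. y \<in> ball x r \<Longrightarrow> cmod (f y) \<le> M"
    and f': "(f has_derivative f') (at x)" "complex_linear f'" and r: "0 < r"
  shows complex_analytic_derivative_bound: "cmod (f' h) \<le> 4 * M / r * norm h"
    and complex_analytic_second_order_bound:
      "norm h < r / 2 \<Longrightarrow> cmod (f (x + h) - f x - f' h) \<le> 32 * M / r\<^sup>2 * (norm h)\<^sup>2"
proof -
  let ?\<phi> = "\<lambda>c. f (x + c *\<^sub>C h)" and ?R = "r / norm h"
  have f'0: "f' 0 = 0"
    using f'(1) has_derivative_bounded_linear linear_simps(3) by blast
  have in_ball: "x + c *\<^sub>C h \<in> ball x r" if "c \<in> ball 0 ?R" "h \<noteq> 0" for c
    using that by (simp add: dist_norm norm_scaleC field_simps)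
  have hol: "?\<phi> holomorphic_on ball 0 ?R" if "h \<noteq> 0"
  proof -
    have "?\<phi> field_differentiable at c" if "c \<in> ball 0 ?R" for c
    proof -
      obtain D where "(f has_derivative D) (at (x + c *\<^sub>C h))" "complex_linear D"
        using f in_ball [OF \<open>c \<in> ball 0 ?R\<close> \<open>h \<noteq> 0\<close>] unfolding complex_analytic_on_def by blast
      from complex_analytic_on_slice [OF this] show ?thesis
        by (auto simp: field_differentiable_def)
    qed
    then show ?thesis
      by (simp add: holomorphic_on_open field_differentiable_def)
  qed
  have deriv0: "deriv ?\<phi> 0 = f' h"
    using complex_analytic_on_slice [of f f' x 0 h] f' by (intro DERIV_imp_deriv) simp
  have le': "cmod (?\<phi> c) \<le> M" if "c \<in> ball 0 ?R" "h \<noteq> 0" for c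
    using le in_ball that by blast
  show "cmod (f' h) \<le> 4 * M / r * norm h"
  proof (cases "h = 0")
    case False
    then have pos: "?R > 0"
      using r by simp
    have sub: "cball 0 (?R / 4) \<subseteq> ball 0 ?R"
      using pos by (auto simp: subset_eq)
    have "cmod ((deriv ^^ 1) ?\<phi> 0) \<le> fact 1 * M / (?R / 4) ^ 1"
    proof (rule Cauchy_inequality)
      show "?\<phi> holomorphic_on ball 0 (?R / 4)"
        by (rule holomorphic_on_subset [OF hol [OF False]]) (use pos in auto)
      show "continuous_on (cball 0 (?R / 4)) ?\<phi>"
        by (rule continuous_on_subset [OF holomorphic_on_imp_continuous_on [OF hol [OF False]] sub])
      show "cmod (?\<phi> y) \<le> M" if "cmod (0 - y) = ?R / 4" for y
        by (rule le' [OF _ False]) (use that pos in auto)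
    qed (use pos in simp)
    then show ?thesis
      using deriv0 by (simp add: field_simps)
  qed (simp add: f'0)
  show "cmod (f (x + h) - f x - f' h) \<le> 32 * M / r\<^sup>2 * (norm h)\<^sup>2" if "norm h < r / 2"
  proof (cases "h = 0")
    case False
    then have "2 < ?R"
      using that by (simp add: field_simps)
    from holomorphic_second_order_bound [OF hol [OF False] le' [OF _ False] this]
    show ?thesis
      unfolding deriv0 using False by (simp add: power_divide)
  qed (simp add: f'0)
qed

lemma complex_linear_imp_bounded_linear:
  fixes L :: "'a :: complex_normed_vector \<Rightarrow> 'b :: complex_normed_vector"
  assumes "complex_linear L" and "\<And>h. norm (L h) \<le> K * norm h"
  shows "bounded_linear L"
proof
  show "L (x + y) = L x + L y" for x y
    using assms(1) by (simp add: complex_linear_def)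
  show "L (r *\<^sub>R x) = r *\<^sub>R L x" for r x
    using assms(1) by (simp add: complex_linear_def flip: scaleC_of_real)
  show "\<exists>K. \<forall>x. norm (L x) \<le> norm x * K"
    using assms(2) by (metis mult.commute)
qed

text \<open>
  By Tychonoff's theorem the evaluations of bounded functions at the indices have a cluster point.
\<close>

lemma exists_limit_filter:
  fixes F :: "'i filter"
  assumes "F \<noteq> bot"
  obtains G where "G \<noteq> bot" "G \<le> F" "\<And>a :: 'i \<Rightarrow> complex. bounded (range a) \<Longrightarrow> \<exists>l. (a \<longlongrightarrow> l) G"
proof -
  \<comment> \<open>Unbounded functions are evaluated to 0, so that every coordinate of
    \<open>?ev n\<close> stays in a compact set and the product of these sets is compact.\<close>
  let ?ev = "\<lambda>n (a :: 'i \<Rightarrow> complex). if bounded (range a) then a n else 0"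
  let ?C = "\<lambda>a :: 'i \<Rightarrow> complex. if bounded (range a) then closure (range a) else {0}"
  have "compactin (product_topology (\<lambda>_. euclidean) UNIV) (PiE UNIV ?C)"
    by (auto simp: compactin_PiE compactin_euclidean_iff)
  then have "compact (PiE UNIV ?C)"
    by (simp only: euclidean_product_topology compactin_euclidean_iff)
  moreover have "filtermap ?ev F \<noteq> bot"
    using assms by (simp add: filtermap_bot_iff)
  moreover have "eventually (\<lambda>\<Phi>. \<Phi> \<in> PiE UNIV ?C) (filtermap ?ev F)"
    by (auto simp: eventually_filtermap intro!: always_eventually closure_subset [THEN subsetD])
  ultimately obtain \<Phi> where \<Phi>: "inf (nhds \<Phi>) (filtermap ?ev F) \<noteq> bot"
    unfolding compact_filter by blast
  \<comment> \<open>The traces on \<open>F\<close> of the preimages of neighbourhoods of the cluster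
    point: along this filter \<open>?ev\<close> converges to \<open>\<Phi>\<close>.\<close>
  let ?G = "inf F (filtercomap ?ev (nhds \<Phi>))"
  show thesis
  proof
    show "?G \<noteq> bot"
    proof
      assume "?G = bot"
      then obtain P Q where "eventually P F" "eventually Q (nhds \<Phi>)" "\<And>n. P n \<Longrightarrow> \<not> Q (?ev n)"
        unfolding trivial_limit_def eventually_inf eventually_filtercomap by blast
      then have "inf (nhds \<Phi>) (filtermap ?ev F) = bot"
        unfolding trivial_limit_def eventually_inf eventually_filtermap
        by (intro exI [of _ Q] exI [of _ "\<lambda>y. \<not> Q y"]) (auto elim: eventually_mono)
      with \<Phi> show False ..
    qed
    show "\<exists>l. (a \<longlongrightarrow> l) ?G" if "bounded (range a)" for a :: "'i \<Rightarrow> complex"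
    proof
      have "(?ev \<longlongrightarrow> \<Phi>) ?G"
        by (rule filterlim_mono [OF filterlim_filtercomap]) auto
      then have "((\<lambda>n. ?ev n a) \<longlongrightarrow> \<Phi> a) ?G"
        by (rule continuous_on_tendsto_compose [OF continuous_on_product_coordinates]) auto
      then show "(a \<longlongrightarrow> \<Phi> a) ?G"
        using that by simp
    qed
  qed simp
qed

text \<open>The derivatives of the \<open>f n\<close> at \<open>x\<close> are bounded in each
  direction, so they converge along a finer filter \<open>G\<close> to a complex linear map. The
  quadratic remainder estimate is uniform in \<open>n\<close> and hence survives the pointwise
  limit, which makes this map the derivative of \<open>g\<close>.\<close>

lemma complex_analytic_on_limit:
  fixes f :: "'i \<Rightarrow> 'a :: complex_banach \<Rightarrow> complex"
  assumes "F \<noteq> bot" and "open U"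
    and an: "\<And>n. complex_analytic_on (f n) U"
    and le: "\<And>n y. y \<in> U \<Longrightarrow> cmod (f n y) \<le> M"
    and lim: "\<And>y. y \<in> U \<Longrightarrow> ((\<lambda>n. f n y) \<longlongrightarrow> g y) F"
  shows "complex_analytic_on g U"
  unfolding complex_analytic_on_def
proof
  fix x assume "x \<in> U"
  obtain G where "G \<noteq> bot" "G \<le> F" and G: "\<And>a :: 'i \<Rightarrow> complex. bounded (range a) \<Longrightarrow> \<exists>l. (a \<longlongrightarrow> l) G"
    using exists_limit_filter [OF \<open>F \<noteq> bot\<close>] by blast
  obtain r where r: "r > 0" "ball x r \<subseteq> U"
    using \<open>open U\<close> \<open>x \<in> U\<close> by (meson openE)
  have anr: "complex_analytic_on (f n) (ball x r)" for n
    using an r(2) by (auto simp: complex_analytic_on_def)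
  have ler: "cmod (f n y) \<le> M" if "y \<in> ball x r" for n y
    using le r(2) that by blast
  have "\<forall>n. \<exists>f'. (f n has_derivative f') (at x) \<and> complex_linear f'"
    using an \<open>x \<in> U\<close> by (auto simp: complex_analytic_on_def)
  then obtain f' where f': "(f n has_derivative f' n) (at x)" "complex_linear (f' n)" for n
    by metis
  note est = complex_analytic_derivative_bound [OF anr ler f' r(1)]
    complex_analytic_second_order_bound [OF anr ler f' r(1)]
  have "\<exists>l. ((\<lambda>n. f' n h) \<longlongrightarrow> l) G" for h
    by (rule G) (use est(1) in \<open>auto intro!: boundedI\<close>)
  then obtain L where L: "((\<lambda>n. f' n h) \<longlongrightarrow> L h) G" for h
    by metis
  have limG: "((\<lambda>n. f n y) \<longlongrightarrow> g y) G" if "y \<in> ball x r" for y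
    using lim [of y] that r(2) tendsto_mono [OF \<open>G \<le> F\<close>] by blast
  have lin: "complex_linear L"
    unfolding complex_linear_def
  proof (intro conjI allI)
    show "L (u + v) = L u + L v" for u v
      by (rule tendsto_unique [OF \<open>G \<noteq> bot\<close> L])
        (use tendsto_add [OF L L] f'(2) in \<open>simp add: complex_linear_def\<close>)
    show "L (a *\<^sub>C u) = a *\<^sub>C L u" for a u
      by (rule tendsto_unique [OF \<open>G \<noteq> bot\<close> L])
        (use tendsto_mult [OF tendsto_const [of a] L] f'(2) in \<open>simp add: complex_linear_def scaleC_complex_def\<close>)
  qed
  have "norm (L h) \<le> 4 * M / r * norm h" for h
    by (rule tendsto_upperbound [OF tendsto_norm [OF L] _ \<open>G \<noteq> bot\<close>]) (intro always_eventually allI est(1))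
  then have "bounded_linear L"
    by (rule complex_linear_imp_bounded_linear [OF lin])
  moreover have "norm (g (x + h) - g x - L h) \<le> 32 * M / r\<^sup>2 * (norm h)\<^sup>2" if "norm h < r / 2" for h
  proof (rule tendsto_upperbound [OF _ _ \<open>G \<noteq> bot\<close>])
    show "((\<lambda>n. norm (f n (x + h) - f n x - f' n h)) \<longlongrightarrow> norm (g (x + h) - g x - L h)) G"
      by (intro tendsto_intros limG L) (use that r in \<open>auto simp: dist_norm\<close>)
  qed (use est(2) that in simp)
  ultimately have "(g has_derivative L) (at x)"
    using r by (intro has_derivative_quadratic [where s = "r / 2" and K = "32 * M / r\<^sup>2"]) simp_all
  with lin show "\<exists>f'. (g has_derivative f') (at x) \<and> complex_linear f'"
    by blast
qed

section \<open>Maps into the space of bounded sequences\<close>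

lemma apply_bcontfun_Bcontfun_linf:
  assumes "\<And>n. cmod (a n) \<le> K"
  shows "apply_bcontfun (Bcontfun a :: linf) = a"
  by (rule Bcontfun_inverse, rule bcontfun_normI [where b = K]) (use assms in auto)

text \<open>The Cauchy estimates hold for all coordinates with the same constants. So the coordinate
  derivatives assemble into a bounded sequence, and the coordinate remainders are controlled in the
  supremum norm.\<close>

lemma complex_analytic_on_linf:
  fixes F :: "'a :: complex_banach \<Rightarrow> linf"
  assumes "open U" and le: "\<And>y. y \<in> U \<Longrightarrow> norm (F y) \<le> M"
    and an: "\<And>j. complex_analytic_on (\<lambda>y. apply_bcontfun (F y) j) U"
  shows "complex_analytic_on F U"
  unfolding complex_analytic_on_def
proof
  fix x assume "x \<in> U"
  let ?f = "\<lambda>j y. apply_bcontfun (F y) j"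
  obtain r where r: "r > 0" "ball x r \<subseteq> U"
    using \<open>open U\<close> \<open>x \<in> U\<close> by (meson openE)
  have anr: "complex_analytic_on (?f n) (ball x r)" for n
    using an r(2) by (auto simp: complex_analytic_on_def)
  have ler: "cmod (?f n y) \<le> M" if "y \<in> ball x r" for n y
    using le r(2) that norm_bounded [of "F y" n] by fastforce
  have "\<forall>n. \<exists>f'. (?f n has_derivative f') (at x) \<and> complex_linear f'"
    using an \<open>x \<in> U\<close> by (auto simp: complex_analytic_on_def)
  then obtain f' where f': "(?f n has_derivative f' n) (at x)" "complex_linear (f' n)" for n
    by metis
  note est = complex_analytic_derivative_bound [OF anr ler f' r(1)]
    complex_analytic_second_order_bound [OF anr ler f' r(1)]
  define L :: "'a \<Rightarrow> linf" where "L h = Bcontfun (\<lambda>n. f' n h)" for h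
  have L [simp]: "apply_bcontfun (L h) = (\<lambda>n. f' n h)" for h
    unfolding L_def by (rule apply_bcontfun_Bcontfun_linf) (rule est(1))
  have lin: "complex_linear L"
    using f'(2) unfolding complex_linear_def
    by (auto intro!: bcontfun_eqI simp: plus_bcontfun.rep_eq)
  have "norm (L h) \<le> 4 * M / r * norm h" for h
    by (rule norm_bound) (simp only: L est(1))
  then have "bounded_linear L"
    by (rule complex_linear_imp_bounded_linear [OF lin])
  moreover have "norm (F (x + h) - F x - L h) \<le> 32 * M / r\<^sup>2 * (norm h)\<^sup>2" if "norm h < r / 2" for h
    by (rule norm_bound) (use est(2) that in \<open>simp add: minus_bcontfun.rep_eq\<close>)
  ultimately have "(F has_derivative L) (at x)"
    using r by (intro has_derivative_quadratic [where s = "r / 2" and K = "32 * M / r\<^sup>2"]) simp_all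
  with lin show "\<exists>f'. (F has_derivative f') (at x) \<and> complex_linear f'"
    by blast
qed

section \<open>Operations on analytic functions\<close>

lemma complex_analytic_on_cong:
  assumes "complex_analytic_on f U" "open U" "\<And>x. x \<in> U \<Longrightarrow> f x = g x"
  shows "complex_analytic_on g U"
  unfolding complex_analytic_on_def
proof
  fix x assume "x \<in> U"
  then obtain f' where f': "(f has_derivative f') (at x)" "complex_linear f'"
    using assms(1) by (auto simp: complex_analytic_on_def)
  have "(g has_derivative f') (at x)"
    by (rule has_derivative_transform_within_open [OF f'(1) \<open>open U\<close> \<open>x \<in> U\<close> assms(3)])
  with f'(2) show "\<exists>f'. (g has_derivative f') (at x) \<and> complex_linear f'"
    by blast
qed

lemma complex_analytic_on_compose:
  assumes "complex_analytic_on f U" "complex_analytic_on g V" "f ` U \<subseteq> V"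
  shows "complex_analytic_on (\<lambda>x. g (f x)) U"
  unfolding complex_analytic_on_def
proof
  fix x assume "x \<in> U"
  then obtain f' where f': "(f has_derivative f') (at x)" "complex_linear f'"
    using assms(1) by (auto simp: complex_analytic_on_def)
  obtain g' where g': "(g has_derivative g') (at (f x))" "complex_linear g'"
    using assms(2,3) \<open>x \<in> U\<close> unfolding complex_analytic_on_def by blast
  have "complex_linear (\<lambda>h. g' (f' h))"
    using f'(2) g'(2) by (simp add: complex_linear_def)
  with has_derivative_compose [OF f'(1) g'(1)]
  show "\<exists>k. ((\<lambda>x. g (f x)) has_derivative k) (at x) \<and> complex_linear k"
    by blast
qed

lemma complex_analytic_on_const: "complex_analytic_on (\<lambda>x. c) U"
  unfolding complex_analytic_on_def complex_linear_def
  by (auto intro!: exI [of _ "\<lambda>x. 0"])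

lemma complex_analytic_on_add:
  assumes "complex_analytic_on f U" "complex_analytic_on g U"
  shows "complex_analytic_on (\<lambda>x. f x + g x) U"
  unfolding complex_analytic_on_def
proof
  fix x assume "x \<in> U"
  then obtain f' g' where f': "(f has_derivative f') (at x)" "complex_linear f'"
    and g': "(g has_derivative g') (at x)" "complex_linear g'"
    using assms unfolding complex_analytic_on_def by blast
  have "complex_linear (\<lambda>h. f' h + g' h)"
    using f'(2) g'(2) by (simp add: complex_linear_def scaleC_add_right)
  with has_derivative_add [OF f'(1) g'(1)]
  show "\<exists>k. ((\<lambda>x. f x + g x) has_derivative k) (at x) \<and> complex_linear k"
    by blast
qed

lemma complex_analytic_on_sum:
  "(\<And>i. i \<in> I \<Longrightarrow> complex_analytic_on (f i) U) \<Longrightarrow> complex_analytic_on (\<lambda>x. \<Sum>i\<in>I. f i x) U"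
  by (induction I rule: infinite_finite_induct)
    (auto intro: complex_analytic_on_const complex_analytic_on_add)

lemma complex_analytic_on_mult:
  fixes f g :: "'a :: complex_banach \<Rightarrow> complex"
  assumes "complex_analytic_on f U" "complex_analytic_on g U"
  shows "complex_analytic_on (\<lambda>x. f x * g x) U"
  unfolding complex_analytic_on_def
proof
  fix x assume "x \<in> U"
  then obtain f' g' where f': "(f has_derivative f') (at x)" "complex_linear f'"
    and g': "(g has_derivative g') (at x)" "complex_linear g'"
    using assms unfolding complex_analytic_on_def by blast
  have "complex_linear (\<lambda>h. f x * g' h + f' h * g x)"
    using f'(2) g'(2) by (simp add: complex_linear_def scaleC_complex_def algebra_simps)
  with has_derivative_mult [OF f'(1) g'(1)]
  show "\<exists>k. ((\<lambda>x. f x * g x) has_derivative k) (at x) \<and> complex_linear k"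
    by blast
qed

lemma complex_analytic_on_prod:
  fixes f :: "'i \<Rightarrow> 'a :: complex_banach \<Rightarrow> complex"
  shows "(\<And>i. i \<in> I \<Longrightarrow> complex_analytic_on (f i) U) \<Longrightarrow> complex_analytic_on (\<lambda>x. \<Prod>i\<in>I. f i x) U"
  by (induction I rule: infinite_finite_induct)
    (auto intro: complex_analytic_on_const complex_analytic_on_mult)

lemma complex_analytic_on_linear:
  assumes "bounded_linear L" "complex_linear L"
  shows "complex_analytic_on L U"
  using assms bounded_linear_imp_has_derivative unfolding complex_analytic_on_def by blast

lemma complex_analytic_on_iff_holomorphic:
  assumes "open U"
  shows "complex_analytic_on f U \<longleftrightarrow> f holomorphic_on U"
proof -
  have "(\<exists>f'. (f has_derivative f') (at x) \<and> complex_linear f') \<longleftrightarrow> (\<exists>d. (f has_field_derivative d) (at x))" for x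
  proof
    assume "\<exists>f'. (f has_derivative f') (at x) \<and> complex_linear f'"
    then obtain f' where f': "(f has_derivative f') (at x)" "complex_linear f'" by blast
    have "f' h = f' 1 * h" for h
      using f'(2) by (metis complex_linear_def mult.commute mult.right_neutral scaleC_complex_def)
    then have "f' = (*) (f' 1)"
      by (rule ext)
    with f'(1) have "(f has_field_derivative f' 1) (at x)"
      unfolding has_field_derivative_def by simp
    then show "\<exists>d. (f has_field_derivative d) (at x)" ..
  next
    assume "\<exists>d. (f has_field_derivative d) (at x)"
    then show "\<exists>f'. (f has_derivative f') (at x) \<and> complex_linear f'"
      by (auto simp: has_field_derivative_def complex_linear_def scaleC_complex_def algebra_simps)
  qed
  then show ?thesis
    using assms by (simp add: complex_analytic_on_def holomorphic_on_open)
qed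

section \<open>Bounded analytic functions and Gleason metrics\<close>

lemma Hinf_bounded:
  assumes "f \<in> Hinf D"
  obtains M where "\<And>x. x \<in> D \<Longrightarrow> cmod (f x) \<le> M"
  using assms by (auto simp: Hinf_def bounded_iff)

lemma HinfI:
  assumes "open D" "complex_analytic_on f D" "\<And>x. x \<in> D \<Longrightarrow> cmod (f x) \<le> M"
  shows "restrict f D \<in> Hinf D"
  using assms complex_analytic_on_cong [of f D "restrict f D"]
  by (auto simp: Hinf_def bounded_iff)

text \<open>Replaces the norm, a real supremum, by pointwise bounds. Boundedness makes the supremum
  an upper bound, and \<open>D \<noteq> {}\<close> makes it the least one.\<close>

lemma Hinf_unit_ball_eq:
  assumes "D \<noteq> {}"
  shows "{f \<in> Hinf D. Hinf_norm D f \<le> 1} =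
    {f \<in> extensional D. complex_analytic_on f D \<and> (\<forall>x\<in>D. cmod (f x) \<le> 1)}"
proof (intro set_eqI iffI; clarsimp)
  fix f assume f: "f \<in> Hinf D" "Hinf_norm D f \<le> 1"
  then have "bdd_above ((\<lambda>x. cmod (f x)) ` D)"
    by (auto simp: Hinf_def bounded_iff bdd_above_def)
  then have "cmod (f x) \<le> 1" if "x \<in> D" for x
    using cSUP_upper [OF that] f(2) by (fastforce simp: Hinf_norm_def)
  then show "f \<in> extensional D \<and> complex_analytic_on f D \<and> (\<forall>x\<in>D. cmod (f x) \<le> 1)"
    using f(1) by (simp add: Hinf_def)
next
  fix f assume "f \<in> extensional D" "complex_analytic_on f D" "\<forall>x\<in>D. cmod (f x) \<le> 1"
  then show "f \<in> Hinf D \<and> Hinf_norm D f \<le> 1"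
    using assms by (auto simp: Hinf_def bounded_iff Hinf_norm_def intro!: cSUP_least)
qed

lemma gleason_spectrum_le:
  assumes "open D" "D \<noteq> {}"
    and "\<And>f. complex_analytic_on f D \<Longrightarrow> (\<And>x. x \<in> D \<Longrightarrow> cmod (f x) \<le> 1) \<Longrightarrow> f \<in> extensional D
      \<Longrightarrow> cmod (\<phi> f - \<psi> f) \<le> C"
  shows "gleason_spectrum D \<phi> \<psi> \<le> C"
  unfolding gleason_spectrum_def Hinf_unit_ball_eq [OF \<open>D \<noteq> {}\<close>]
proof (rule cSUP_least)
  \<comment> \<open>The zero function shows that the supremum is over a nonempty set.\<close>
  have "complex_analytic_on (\<lambda>x\<in>D. 0 :: complex) D"
    by (rule complex_analytic_on_cong [OF complex_analytic_on_const \<open>open D\<close>]) simp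
  then show "{f \<in> extensional D. complex_analytic_on f D \<and> (\<forall>x\<in>D. cmod (f x) \<le> 1)} \<noteq> {}"
    by (auto intro!: exI [of _ "\<lambda>x\<in>D. 0"])
qed (use assms(3) in auto)

text \<open>Points act as their evaluations, so the same two estimates serve both Gleason
  metrics.\<close>

lemma gleason_domain_eq: "gleason_domain D z w = gleason_spectrum D (\<lambda>f. f z) (\<lambda>f. f w)"
  by (simp add: gleason_domain_def gleason_spectrum_def)

text \<open>The premise \<open>bound\<close> makes the set of differences bounded above; only then
  does the real supremum dominate its members.\<close>

lemma gleason_spectrum_ge:
  assumes "open D" "D \<noteq> {}"
    and bound: "\<And>f. f \<in> Hinf D \<Longrightarrow> (\<And>x. x \<in> D \<Longrightarrow> cmod (f x) \<le> 1) \<Longrightarrow> cmod (\<phi> f - \<psi> f) \<le> C"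
    and f: "complex_analytic_on f D" "\<And>x. x \<in> D \<Longrightarrow> cmod (f x) \<le> 1"
  shows "cmod (\<phi> (restrict f D) - \<psi> (restrict f D)) \<le> gleason_spectrum D \<phi> \<psi>"
  unfolding gleason_spectrum_def
proof (rule cSUP_upper)
  have eq: "{f \<in> Hinf D. Hinf_norm D f \<le> 1} \<subseteq> {f \<in> Hinf D. \<forall>x\<in>D. cmod (f x) \<le> 1}"
    using Hinf_unit_ball_eq [OF \<open>D \<noteq> {}\<close>] by blast
  show "restrict f D \<in> {f \<in> Hinf D. Hinf_norm D f \<le> 1}"
    unfolding Hinf_unit_ball_eq [OF \<open>D \<noteq> {}\<close>]
    using complex_analytic_on_cong [OF f(1) \<open>open D\<close>, of "restrict f D"] f(2) by auto
  show "bdd_above ((\<lambda>f. cmod (\<phi> f - \<psi> f)) ` {f \<in> Hinf D. Hinf_norm D f \<le> 1})"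
    unfolding bdd_above_def using eq bound by blast
qed

section \<open>Reduction to the coordinates on the unit ball of bounded sequences\<close>

text \<open>The modulus is continuous on a compact bidisc and below 1 everywhere, so its maximum is
  below 1. This gives bounds uniform in the coordinates of bounded sequences.\<close>

lemma Moebius_function_uniform_bound:
  assumes "s < 1"
  obtains t where "t < 1" "\<And>a b. cmod a \<le> s \<Longrightarrow> cmod b \<le> s \<Longrightarrow> cmod (Moebius_function 0 a b) \<le> t"
proof (cases "0 \<le> s")
  case True
  let ?K = "cball (0 :: complex) s \<times> cball (0 :: complex) s"
  let ?m = "\<lambda>(a, b). cmod (Moebius_function 0 a b)"
  have "1 - cnj a * b \<noteq> 0" if "cmod a \<le> s" "cmod b \<le> s" for a b
  proof -
    have "cmod (cnj a * b) < 1"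
      using that assms mult_left_le [of "cmod b" "cmod a"] by (simp add: norm_mult)
    then show ?thesis by auto
  qed
  then have "continuous_on ?K ?m"
    unfolding case_prod_unfold Moebius_function_simple by (auto intro!: continuous_intros)
  moreover have "compact ?K" "?K \<noteq> {}"
    using True by (auto intro: compact_Times)
  ultimately obtain p where p: "p \<in> ?K" "\<And>q. q \<in> ?K \<Longrightarrow> ?m q \<le> ?m p"
    using continuous_attains_sup by metis
  show thesis
  proof (rule that)
    show "?m p < 1"
      using p(1) assms by (auto intro!: Moebius_function_norm_lt_1)
    show "cmod (Moebius_function 0 a b) \<le> ?m p" if "cmod a \<le> s" "cmod b \<le> s" for a b
      using p(2) [of "(a, b)"] that by simp
  qed
next
  case False
  show thesis
  proof (rule that [of 0])
    show "cmod (Moebius_function 0 a b) \<le> 0" if "cmod a \<le> s" for a b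
      using norm_ge_zero [of a] that False by linarith
  qed auto
qed

text \<open>
  The points \<open>w\<close> and \<open>z\<close> lie on an analytic disc \<open>\<psi>\<close> in the unit ball with \<open>\<psi> 0 = w\<close> and \<open>\<psi> p = z\<close>, where \<open>p\<close>
  is the supremum of the pseudohyperbolic distances of their coordinates. So \<open>g\<close> sees \<open>z\<close> and \<open>w\<close> no
  better than the functions of a single coordinate do.
\<close>

lemma Hinf_polydisc_diff_le:
  fixes z w :: linf
  assumes z: "norm z < 1" and w: "norm w < 1"
    and g: "complex_analytic_on g (ball 0 1)" "\<And>x. x \<in> ball 0 1 \<Longrightarrow> cmod (g x) \<le> 1"
    and C: "\<And>k j. k holomorphic_on ball 0 1 \<Longrightarrow> (\<And>\<zeta>. \<zeta> \<in> ball 0 1 \<Longrightarrow> cmod (k \<zeta>) \<le> 1)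
      \<Longrightarrow> cmod (k (apply_bcontfun z j) - k (apply_bcontfun w j)) \<le> C"
  shows "cmod (g z - g w) \<le> C"
proof -
  let ?z = "apply_bcontfun z" and ?w = "apply_bcontfun w"
  have zj: "cmod (?z j) < 1" and wj: "cmod (?w j) < 1" for j
    using norm_bounded [of z j] norm_bounded [of w j] z w by linarith+
  define \<mu> where "\<mu> j = Moebius_function 0 (?w j) (?z j)" for j
  have "max (norm z) (norm w) < 1"
    using z w by simp
  from Moebius_function_uniform_bound [OF this] obtain t where "t < 1"
    and "\<And>a b. cmod a \<le> max (norm z) (norm w) \<Longrightarrow> cmod b \<le> max (norm z) (norm w)
      \<Longrightarrow> cmod (Moebius_function 0 a b) \<le> t"
    by metis
  then have t: "t < 1" "\<And>j. cmod (\<mu> j) \<le> t"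
    by (simp_all add: \<mu>_def le_max_iff_disj norm_bounded)
  define p where "p = (SUP j. cmod (\<mu> j))"
  have bdd: "bdd_above (range (\<lambda>j. cmod (\<mu> j)))"
    using t(2) by (auto simp: bdd_above_def)
  have \<mu>_le: "cmod (\<mu> j) \<le> p" for j
    unfolding p_def by (rule cSUP_upper [OF _ bdd]) simp
  have p1: "p < 1"
    unfolding p_def by (rule le_less_trans [OF cSUP_least t(1)]) (simp_all add: t(2))
  have p0: "0 \<le> p"
    using \<mu>_le [of 0] norm_ge_zero order_trans by blast
  have inv: "Moebius_function 0 (- ?w j) (\<mu> j) = ?z j" for j
    unfolding \<mu>_def by (rule Moebius_function_compose) (use zj wj in auto)
  \<comment> \<open>If \<open>p = 0\<close>, then all \<open>\<mu> j\<close> vanish and division by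
    zero gives \<open>\<nu> j = 0\<close>, so \<open>of_real p * \<nu> j = \<mu> j\<close> holds in
    this case too.\<close>
  define \<nu> where "\<nu> j = \<mu> j / of_real p" for j
  have \<nu>_le: "cmod (\<nu> j) \<le> 1" for j
    using \<mu>_le [of j] p0 by (simp add: \<nu>_def norm_divide divide_le_eq)
  have \<nu>p: "of_real p * \<nu> j = \<mu> j" for j
    using \<mu>_le [of j] by (auto simp: \<nu>_def)
  define \<psi> :: "complex \<Rightarrow> linf"
    where "\<psi> \<zeta> = Bcontfun (\<lambda>j. Moebius_function 0 (- ?w j) (\<zeta> * \<nu> j))" for \<zeta>
  have \<psi>: "apply_bcontfun (\<psi> \<zeta>) = (\<lambda>j. Moebius_function 0 (- ?w j) (\<zeta> * \<nu> j))"
    and \<psi>_ball: "norm (\<psi> \<zeta>) < 1" if "cmod \<zeta> < 1" for \<zeta>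
  proof -
    \<comment> \<open>Coordinates of modulus below 1 could still have supremum 1; a bound
      \<open>t < 1\<close> common to all \<open>j\<close> keeps \<open>\<psi> \<zeta>\<close> in the
      open ball.\<close>
    have "max (cmod \<zeta>) (norm w) < 1"
      using that w by simp
    from Moebius_function_uniform_bound [OF this] obtain t where "t < 1"
      and t: "\<And>a b. cmod a \<le> max (cmod \<zeta>) (norm w) \<Longrightarrow> cmod b \<le> max (cmod \<zeta>) (norm w)
        \<Longrightarrow> cmod (Moebius_function 0 a b) \<le> t"
      by metis
    have le: "cmod (Moebius_function 0 (- ?w j) (\<zeta> * \<nu> j)) \<le> t" for j
      using norm_bounded [of w j] mult_left_le [OF \<nu>_le [of j] norm_ge_zero [of \<zeta>]]
      by (intro t) (simp_all add: norm_mult le_max_iff_disj)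
    then show *: "apply_bcontfun (\<psi> \<zeta>) = (\<lambda>j. Moebius_function 0 (- ?w j) (\<zeta> * \<nu> j))"
      unfolding \<psi>_def by (rule apply_bcontfun_Bcontfun_linf)
    have "norm (\<psi> \<zeta>) \<le> t"
      by (rule norm_bound) (simp add: * le)
    with \<open>t < 1\<close> show "norm (\<psi> \<zeta>) < 1" by simp
  qed
  have \<psi>0: "\<psi> 0 = w" and \<psi>p: "\<psi> (of_real p) = z"
    using p0 p1 by (auto intro!: bcontfun_eqI simp: \<psi> \<nu>p inv Moebius_function_of_zero)
  have "complex_analytic_on \<psi> (ball 0 1)"
  proof (rule complex_analytic_on_linf)
    show "norm (\<psi> \<zeta>) \<le> 1" if "\<zeta> \<in> ball 0 1" for \<zeta>
      using \<psi>_ball [of \<zeta>] that by simp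
    fix j
    have "(\<lambda>\<zeta>. Moebius_function 0 (- ?w j) (\<zeta> * \<nu> j)) holomorphic_on ball 0 1"
    proof (rule holomorphic_on_compose_gen [unfolded o_def, where g = "Moebius_function 0 (- ?w j)"])
      show "Moebius_function 0 (- ?w j) holomorphic_on ball 0 1"
        by (rule Moebius_function_holomorphic) (simp add: wj)
      show "(\<lambda>\<zeta>. \<zeta> * \<nu> j) ` ball 0 1 \<subseteq> ball 0 1"
        by (auto simp: norm_mult intro: le_less_trans [OF mult_left_le [OF \<nu>_le norm_ge_zero]])
    qed (intro holomorphic_intros)
    then show "complex_analytic_on (\<lambda>\<zeta>. apply_bcontfun (\<psi> \<zeta>) j) (ball 0 1)"
      by (intro complex_analytic_on_cong [OF iffD2 [OF complex_analytic_on_iff_holomorphic]]) (auto simp: \<psi>)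
  qed simp
  then have an: "complex_analytic_on (\<lambda>\<zeta>. g (\<psi> \<zeta>)) (ball 0 1)"
    by (rule complex_analytic_on_compose [OF _ g(1)]) (use \<psi>_ball in auto)
  define h where "h = (\<lambda>\<zeta>. g (\<psi> \<zeta>))"
  have hol: "h holomorphic_on ball 0 1"
    using an by (simp add: complex_analytic_on_iff_holomorphic h_def)
  have h_le: "cmod (h \<zeta>) \<le> 1" if "\<zeta> \<in> ball 0 1" for \<zeta>
    unfolding h_def by (rule g(2)) (use \<psi>_ball that in simp)
  have le: "cmod (h (of_real (cmod (\<mu> j))) - h 0) \<le> C" for j
  proof -
    \<comment> \<open>The rotation \<open>e\<close> carries \<open>\<mu> j\<close> to its modulus.
      Hence \<open>h\<close>, composed with the rotated Moebius map of centre \<open>?w j\<close>,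
      is a function of one coordinate with value \<open>h 0\<close> at \<open>?w j\<close> and
      \<open>h (cmod (\<mu> j))\<close> at \<open>?z j\<close>.\<close>
    define e where "e = (if \<mu> j = 0 then 1 else of_real (cmod (\<mu> j)) / \<mu> j)"
    have e: "cmod e = 1" "\<mu> j * e = of_real (cmod (\<mu> j))"
      by (auto simp: e_def norm_divide)
    have im: "Moebius_function 0 (?w j) \<zeta> * e \<in> ball 0 1" if "\<zeta> \<in> ball 0 1" for \<zeta>
      using Moebius_function_norm_lt_1 [OF wj, of \<zeta>] that by (simp add: norm_mult e)
    have "(\<lambda>\<zeta>. h (Moebius_function 0 (?w j) \<zeta> * e)) holomorphic_on ball 0 1"
    proof (rule holomorphic_on_compose_gen [unfolded o_def, OF _ hol])
      show "(\<lambda>\<zeta>. Moebius_function 0 (?w j) \<zeta> * e) holomorphic_on ball 0 1"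
        by (intro holomorphic_intros Moebius_function_holomorphic wj)
    qed (use im in blast)
    then have "cmod (h (Moebius_function 0 (?w j) (?z j) * e) - h (Moebius_function 0 (?w j) (?w j) * e)) \<le> C"
      by (rule C) (rule h_le, rule im)
    then show ?thesis
      by (simp add: e Moebius_function_eq_zero flip: \<mu>_def)
  qed
  \<comment> \<open>The supremum \<open>p\<close> may not be attained, so the bound at the points
    \<open>cmod (\<mu> j)\<close> is carried to \<open>p\<close> by continuity of
    \<open>h\<close>.\<close>
  have "p \<in> closure (range (\<lambda>j. cmod (\<mu> j)))"
    unfolding p_def by (rule closure_contains_Sup) (use bdd in auto)
  then obtain x where x: "\<And>n. x n \<in> range (\<lambda>j. cmod (\<mu> j))" "x \<longlonglongrightarrow> p"
    unfolding closure_sequential by blast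
  have "isCont h (of_real p)"
    using holomorphic_on_imp_continuous_on [OF hol] p0 p1 by (simp add: continuous_on_eq_continuous_at)
  then have "(\<lambda>n. h (of_real (x n))) \<longlonglongrightarrow> h (of_real p)"
    by (rule isCont_tendsto_compose) (intro tendsto_intros x(2))
  then have "(\<lambda>n. cmod (h (of_real (x n)) - h 0)) \<longlonglongrightarrow> cmod (h (of_real p) - h 0)"
    by (intro tendsto_intros)
  moreover have "cmod (h (of_real (x n)) - h 0) \<le> C" for n
    using x(1) [of n] le by auto
  ultimately have "cmod (h (of_real p) - h 0) \<le> C"
    using LIMSEQ_le_const2 by blast
  then show ?thesis
    by (simp add: h_def \<psi>0 \<psi>p)
qed

section \<open>The approximating maps into the ball of null sequences\<close>

definition coord :: "nat \<Rightarrow> c0 \<Rightarrow> complex"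
  where "coord k x = apply_bcontfun (linf_of_c0 x) k"

lemma coord_simps [simp]:
  "coord k (x + y) = coord k x + coord k y" "coord k (c *\<^sub>C x) = c * coord k x" "coord k 0 = 0"
  by (simp_all add: coord_def plus_c0.rep_eq scaleC_c0.rep_eq zero_c0.rep_eq scaleC_complex_def)

lemma coord_sum [simp]: "coord k (\<Sum>i\<in>I. f i) = (\<Sum>i\<in>I. coord k (f i))"
  by (induction I rule: infinite_finite_induct) auto

lemma coord_le_norm: "cmod (coord k x) \<le> norm x"
  unfolding coord_def norm_c0.rep_eq by (rule norm_bounded)

lemma norm_c0_le: "(\<And>k. cmod (coord k x) \<le> b) \<Longrightarrow> norm x \<le> b"
  unfolding coord_def norm_c0.rep_eq by (rule norm_bound)

text \<open>All but finitely many coordinates of a null sequence are below \<open>1 / 2\<close>, so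
  the norm is at most a maximum of finitely many numbers below 1.\<close>

lemma norm_c0_less_1:
  assumes "\<And>k. cmod (coord k x) < 1"
  shows "norm x < 1"
proof -
  have "(\<lambda>k. coord k x) \<longlonglongrightarrow> 0"
    using linf_of_c0 [of x] by (simp add: coord_def [abs_def])
  from LIMSEQ_D [OF this, of "1 / 2"] obtain K where K: "\<forall>k\<ge>K. cmod (coord k x) < 1 / 2"
    by auto
  let ?m = "Max (insert (1 / 2) ((\<lambda>k. cmod (coord k x)) ` {..<K}))"
  have "cmod (coord k x) \<le> ?m" for k
  proof (cases "k < K")
    case False
    then have "cmod (coord k x) \<le> 1 / 2"
      using K by (simp add: less_imp_le)
    also have "\<dots> \<le> ?m"
      by (rule Max_ge) auto
    finally show ?thesis .
  qed (auto intro: Max_ge)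
  then have "norm x \<le> ?m"
    by (rule norm_c0_le)
  also have "?m < 1"
    using assms by (subst Max_less_iff) auto
  finally show ?thesis .
qed

lemma complex_analytic_on_coord: "complex_analytic_on (coord k) U"
proof (rule complex_analytic_on_linear)
  show "complex_linear (coord k)"
    by (simp add: complex_linear_def scaleC_complex_def)
  then show "bounded_linear (coord k)"
    by (rule complex_linear_imp_bounded_linear [where K = 1]) (simp add: coord_le_norm)
qed

lift_definition unit_c0 :: "nat \<Rightarrow> c0" is "\<lambda>k. Bcontfun (\<lambda>i. if i = k then 1 else 0)"
proof -
  fix k :: nat
  have "apply_bcontfun (Bcontfun (\<lambda>i. if i = k then 1 else 0) :: linf) = (\<lambda>i. if i = k then 1 else 0)"
    by (rule apply_bcontfun_Bcontfun_linf [where K = 1]) simp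
  moreover have "(\<lambda>i. if i = k then 1 else 0 :: complex) \<longlonglongrightarrow> 0"
    by (rule tendsto_eventually) (auto intro: eventually_mono [OF eventually_gt_at_top [of k]])
  ultimately show "apply_bcontfun (Bcontfun (\<lambda>i. if i = k then 1 else 0) :: linf) \<longlonglongrightarrow> 0"
    by simp
qed

lemma coord_unit_c0 [simp]: "coord i (unit_c0 k) = (if i = k then 1 else 0)"
proof -
  have "apply_bcontfun (Bcontfun (\<lambda>i. if i = k then 1 else 0) :: linf) = (\<lambda>i. if i = k then 1 else 0)"
    by (rule apply_bcontfun_Bcontfun_linf [where K = 1]) simp
  then show ?thesis
    by (simp add: coord_def unit_c0.rep_eq)
qed

text \<open>The gaps \<open>1 - radius n\<close> from \<open>n = N\<close> on sum to
  \<open>(1 / 2) ^ N\<close>, the error allowed in \<open>blaschke_orbit\<close>.\<close>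

definition radius :: "nat \<Rightarrow> complex"
  where "radius n = of_real (1 - (1 / 2) ^ Suc n)"

lemma norm_radius: "cmod (radius n) < 1"
proof -
  have "0 < (1 / 2 :: real) ^ Suc n" "(1 / 2 :: real) ^ Suc n \<le> 1"
    by (rule zero_less_power, simp, rule power_le_one, simp_all)
  then show ?thesis
    unfolding radius_def norm_of_real by linarith
qed

text \<open>Block \<open>n\<close> consists of the indices \<open>prod_encode (n, j)\<close>. The
  cutoff \<open>j \<le> n\<close> makes the support finite, while every coordinate \<open>j\<close>
  is present from \<open>n = j\<close> on.\<close>

definition orbit :: "nat \<Rightarrow> linf \<Rightarrow> c0"
  where "orbit n z = (\<Sum>j\<le>n. Moebius_function 0 (- radius n) (apply_bcontfun z j) *\<^sub>C unit_c0 (prod_encode (n, j)))"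

lemma coord_orbit:
  "coord (prod_encode (m, j)) (orbit n z) =
    (if m = n \<and> j \<le> n then Moebius_function 0 (- radius n) (apply_bcontfun z j) else 0)"
  by (auto simp: orbit_def if_distrib cong: if_cong)

lemma cmod_linf_less: "norm z < 1 \<Longrightarrow> cmod (apply_bcontfun z j) < 1" for z :: linf
  using norm_bounded [of z j] by linarith

lemma coord_orbit_less:
  assumes "norm z < 1"
  shows "cmod (coord k (orbit n z)) < 1"
proof -
  obtain m j where "k = prod_encode (m, j)"
    by (metis prod_decode_inverse surj_pair)
  then show ?thesis
    using Moebius_function_norm_lt_1 [of "- radius n" "apply_bcontfun z j"] assms
    by (simp add: coord_orbit norm_radius cmod_linf_less)
qed

lemma orbit_in_ball: "z \<in> ball 0 1 \<Longrightarrow> orbit n z \<in> ball 0 1"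
  using coord_orbit_less norm_c0_less_1 by simp

text \<open>
  For different \<open>n\<close> the sequences \<open>orbit n z\<close> have disjoint supports. Hence the norm of the sum
  does not grow with \<open>N\<close>, and \<open>\<bar>L (orbit n z)\<bar>\<close> is summable in \<open>n\<close> for every functional \<open>L\<close>.
\<close>

lemma norm_sum_orbit_le:
  assumes "norm z < 1" and "\<And>n. cmod (c n) \<le> 1"
  shows "norm (\<Sum>n<N. c n *\<^sub>C orbit n z) \<le> 1"
proof (rule norm_c0_le)
  fix k
  obtain m j where k: "k = prod_encode (m, j)"
    by (metis prod_decode_inverse surj_pair)
  have "coord k (\<Sum>n<N. c n *\<^sub>C orbit n z) = (\<Sum>n<N. if n = m then c m * coord k (orbit m z) else 0)"
    unfolding coord_sum coord_simps by (rule sum.cong) (auto simp: k coord_orbit)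
  also have "\<dots> = (if m < N then c m * coord k (orbit m z) else 0)"
    by simp
  also have "cmod \<dots> \<le> 1"
    using coord_orbit_less [OF assms(1), of k m] assms(2) [of m] by (simp add: norm_mult mult_le_one)
  finally show "cmod (coord k (\<Sum>n<N. c n *\<^sub>C orbit n z)) \<le> 1" .
qed

lemma orbit_weakly_null:
  assumes L: "L \<in> complex_dual" and z: "norm z < 1"
  shows "(\<lambda>n. L (orbit n z)) \<longlonglongrightarrow> 0"
proof -
  have lin: "bounded_linear L" "L (x + y) = L x + L y" "L (a *\<^sub>C x) = a * L x" for x y a
    using L by (auto simp: complex_dual_def complex_linear_def scaleC_complex_def)
  obtain K where K: "\<And>x. cmod (L x) \<le> norm x * K" "K \<ge> 0"
    using bounded_linear.nonneg_bounded [OF lin(1)] by blast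
  \<comment> \<open>These phases turn the sum of the moduli into \<open>L\<close> of a single vector
    of norm at most 1. Where \<open>L\<close> vanishes, \<open>c n\<close> is 0.\<close>
  define c where "c n = cnj (sgn (L (orbit n z)))" for n
  have c: "c n * L (orbit n z) = of_real (cmod (L (orbit n z)))" "cmod (c n) \<le> 1" for n
  proof -
    show "c n * L (orbit n z) = of_real (cmod (L (orbit n z)))"
      using complex_norm_square [of "L (orbit n z)"]
      by (cases "L (orbit n z) = 0") (simp_all add: c_def sgn_eq divide_eq_eq power2_eq_square mult.commute)
    show "cmod (c n) \<le> 1"
      by (simp add: c_def norm_sgn)
  qed
  have "summable (\<lambda>n. cmod (L (orbit n z)))"
  proof (rule summableI_nonneg_bounded)
    fix N
    have "(\<Sum>n<N. cmod (L (orbit n z))) = cmod (of_real (\<Sum>n<N. cmod (L (orbit n z))))"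
      unfolding norm_of_real by (simp add: sum_nonneg)
    also have "of_real (\<Sum>n<N. cmod (L (orbit n z))) = L (\<Sum>n<N. c n *\<^sub>C orbit n z)"
      using lin by (simp add: linear_sum bounded_linear.linear c)
    also have "cmod \<dots> \<le> norm (\<Sum>n<N. c n *\<^sub>C orbit n z) * K"
      by (rule K)
    also have "\<dots> \<le> 1 * K"
      by (rule mult_right_mono [OF norm_sum_orbit_le]) (use z c K in auto)
    finally show "(\<Sum>n<N. cmod (L (orbit n z))) \<le> K" by simp
  qed simp
  then show ?thesis
    using summable_LIMSEQ_zero tendsto_norm_zero_iff by blast
qed

lemma complex_analytic_on_orbit: "complex_analytic_on (orbit n) (ball 0 1)"
  unfolding orbit_def [abs_def]
proof (rule complex_analytic_on_sum)
  fix j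
  let ?e = "unit_c0 (prod_encode (n, j))"
  have "complex_analytic_on (\<lambda>z :: linf. apply_bcontfun z j) (ball 0 1)"
  proof (rule complex_analytic_on_linear)
    show "complex_linear (\<lambda>z :: linf. apply_bcontfun z j)"
      by (simp add: complex_linear_def plus_bcontfun.rep_eq)
    then show "bounded_linear (\<lambda>z :: linf. apply_bcontfun z j)"
      by (rule complex_linear_imp_bounded_linear [where K = 1]) (simp add: norm_bounded)
  qed
  moreover have "complex_analytic_on (Moebius_function 0 (- radius n)) (ball 0 1)"
    by (simp add: complex_analytic_on_iff_holomorphic Moebius_function_holomorphic norm_radius)
  ultimately have "complex_analytic_on (\<lambda>z :: linf. Moebius_function 0 (- radius n) (apply_bcontfun z j)) (ball 0 1)"
    by (rule complex_analytic_on_compose) (auto simp: cmod_linf_less)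
  moreover have "complex_analytic_on (\<lambda>c. c *\<^sub>C ?e) UNIV"
    by (rule complex_analytic_on_linear [OF bounded_linear_scaleC_left])
      (simp add: complex_linear_def scaleC_add_left scaleC_scaleC scaleC_complex_def)
  ultimately show "complex_analytic_on (\<lambda>z. Moebius_function 0 (- radius n) (apply_bcontfun z j) *\<^sub>C ?e) (ball 0 1)"
    by (rule complex_analytic_on_compose) simp
qed

section \<open>Blaschke-type products that recover the coordinates\<close>

text \<open>Acts like a free ultrafilter on the naturals. One fixed choice serves both the infinite
  products and the map into the fiber.\<close>

definition limit_filter :: "nat filter"
  where "limit_filter = (SOME G. G \<noteq> bot \<and> G \<le> sequentially \<and>
    (\<forall>a :: nat \<Rightarrow> complex. bounded (range a) \<longrightarrow> (\<exists>l. (a \<longlongrightarrow> l) G)))"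

definition glim :: "(nat \<Rightarrow> complex) \<Rightarrow> complex"
  where "glim a = Lim limit_filter a"

lemma limit_filter: "limit_filter \<noteq> bot" "limit_filter \<le> sequentially"
  and glim: "bounded (range a) \<Longrightarrow> (a \<longlongrightarrow> glim a) limit_filter"
proof -
  let ?P = "\<lambda>G. G \<noteq> bot \<and> G \<le> sequentially \<and>
    (\<forall>a :: nat \<Rightarrow> complex. bounded (range a) \<longrightarrow> (\<exists>l. (a \<longlongrightarrow> l) G))"
  have "\<exists>G. ?P G"
    by (rule exists_limit_filter [of sequentially]) auto
  from someI_ex [OF this] have *: "?P limit_filter"
    unfolding limit_filter_def .
  then show bot: "limit_filter \<noteq> bot" and "limit_filter \<le> sequentially"
    by blast+
  show "(a \<longlongrightarrow> glim a) limit_filter" if "bounded (range a)"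
    using * that tendsto_Lim [OF bot] unfolding glim_def by metis
qed

lemma glim_eqI: "(a \<longlongrightarrow> l) limit_filter \<Longrightarrow> glim a = l"
  unfolding glim_def by (rule tendsto_Lim [OF limit_filter(1)])

text \<open>Bounds that hold eventually along \<open>sequentially\<close> hold along the finer
  \<open>limit_filter\<close> and pass to the limit.\<close>

lemma cmod_glim_le:
  assumes "bounded (range a)" "eventually (\<lambda>n. cmod (a n - c) \<le> C) sequentially"
  shows "cmod (glim a - c) \<le> C"
proof (rule tendsto_upperbound)
  show "((\<lambda>n. cmod (a n - c)) \<longlongrightarrow> cmod (glim a - c)) limit_filter"
    by (intro tendsto_intros glim assms)
  show "eventually (\<lambda>n. cmod (a n - c) \<le> C) limit_filter"
    using assms(2) limit_filter(2) by (rule filter_leD [rotated])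
qed (rule limit_filter)

definition partial_blaschke :: "nat \<Rightarrow> nat \<Rightarrow> nat \<Rightarrow> c0 \<Rightarrow> complex"
  where "partial_blaschke N j M x = (\<Prod>n=N..M. - Moebius_function 0 (radius n) (coord (prod_encode (n, j)) x))"

text \<open>
  The factors are negated so that their values at \<open>0\<close> are the radii, which tend to \<open>1\<close>. On an orbit
  one factor is minus a coordinate of \<open>z\<close>, whence the outer sign.
\<close>

definition blaschke :: "nat \<Rightarrow> nat \<Rightarrow> c0 \<Rightarrow> complex"
  where "blaschke N j x = - glim (\<lambda>M. partial_blaschke N j M x)"

lemma blaschke_factor_less:
  assumes "x \<in> ball 0 1"
  shows "cmod (Moebius_function 0 (radius n) (coord k x)) < 1"
  using assms coord_le_norm [of k x] by (intro Moebius_function_norm_lt_1 norm_radius) auto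

lemma partial_blaschke_le:
  assumes "x \<in> ball 0 1"
  shows "cmod (partial_blaschke N j M x) \<le> 1"
  unfolding partial_blaschke_def prod_norm [symmetric]
  by (rule prod_le_1) (use blaschke_factor_less [OF assms] in \<open>simp add: less_imp_le\<close>)

lemma bounded_partial_blaschke: "x \<in> ball 0 1 \<Longrightarrow> bounded (range (\<lambda>M. partial_blaschke N j M x))"
  using partial_blaschke_le by (auto intro!: boundedI)

text \<open>Splitting off the factor with index \<open>N\<close> bounds all later partial products
  by its modulus, which is below 1 and independent of \<open>M\<close>. Strictness is what allows
  composition with functions on the open disc.\<close>

lemma blaschke_less:
  assumes "x \<in> ball 0 1"
  shows "cmod (blaschke N j x) < 1"
proof -
  let ?b = "cmod (Moebius_function 0 (radius N) (coord (prod_encode (N, j)) x))"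
  have "cmod (partial_blaschke N j M x) \<le> ?b" if "M \<ge> N" for M
  proof -
    have "partial_blaschke N j M x = - Moebius_function 0 (radius N) (coord (prod_encode (N, j)) x)
        * partial_blaschke (Suc N) j M x"
      unfolding partial_blaschke_def using that by (simp add: prod.atLeast_Suc_atMost)
    then show ?thesis
      using partial_blaschke_le [OF assms, of "Suc N" j M] by (simp add: norm_mult mult_left_le)
  qed
  then have "cmod (glim (\<lambda>M. partial_blaschke N j M x) - 0) \<le> ?b"
    by (intro cmod_glim_le bounded_partial_blaschke assms) (auto intro: eventually_sequentiallyI [of N])
  also have "?b < 1"
    by (rule blaschke_factor_less [OF assms])
  finally show ?thesis
    by (simp add: blaschke_def)
qed

lemma complex_analytic_on_partial_blaschke: "complex_analytic_on (partial_blaschke N j M) (ball 0 1)"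
  unfolding partial_blaschke_def [abs_def]
proof (rule complex_analytic_on_prod)
  fix n
  have "complex_analytic_on (\<lambda>c. - Moebius_function 0 (radius n) c) (ball 0 1)"
    by (simp add: complex_analytic_on_iff_holomorphic Moebius_function_holomorphic norm_radius holomorphic_on_minus)
  then show "complex_analytic_on (\<lambda>x. - Moebius_function 0 (radius n) (coord (prod_encode (n, j)) x)) (ball 0 1)"
    by (rule complex_analytic_on_compose [OF complex_analytic_on_coord])
      (auto intro: le_less_trans [OF coord_le_norm])
qed

lemma complex_analytic_on_blaschke: "complex_analytic_on (blaschke N j) (ball 0 1)"
proof -
  have "complex_analytic_on (\<lambda>x. glim (\<lambda>M. partial_blaschke N j M x)) (ball 0 1)"
    by (rule complex_analytic_on_limit [OF limit_filter(1) _ complex_analytic_on_partial_blaschke partial_blaschke_le])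
      (auto intro!: glim bounded_partial_blaschke)
  from complex_analytic_on_mult [OF complex_analytic_on_const [of "- 1"] this]
  show ?thesis
    by (simp add: blaschke_def [abs_def])
qed

text \<open>On \<open>orbit n z\<close> the factor with index \<open>n\<close> undoes the Moebius
  map and gives \<open>- z\<^sub>j\<close>; every other factor sees the coordinate 0 and gives its
  radius. The error is thus at most 1 minus a product of radii.\<close>

lemma blaschke_orbit:
  assumes z: "norm z < 1" and "N \<le> n" "j \<le> n"
  shows "cmod (blaschke N j (orbit n z) - apply_bcontfun z j) \<le> (1 / 2) ^ N"
proof -
  let ?z = "apply_bcontfun z j"
  have x: "orbit n z \<in> ball 0 1"
    using orbit_in_ball z by simp
  have pw: "0 \<le> (1 / 2 :: real) ^ m" "(1 / 2 :: real) ^ m \<le> 1" for m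
    by (simp, rule power_le_one) simp_all
  have "cmod (partial_blaschke N j M (orbit n z) - (- ?z)) \<le> (1 / 2) ^ N" if "n \<le> M" for M
  proof -
    let ?c = "\<Prod>m\<in>{N..M} - {n}. 1 - (1 / 2 :: real) ^ Suc m"
    have "partial_blaschke N j M (orbit n z) = - ?z * of_real ?c"
    proof -
      have "partial_blaschke N j M (orbit n z) =
          - Moebius_function 0 (radius n) (coord (prod_encode (n, j)) (orbit n z)) *
          (\<Prod>m\<in>{N..M} - {n}. - Moebius_function 0 (radius m) (coord (prod_encode (m, j)) (orbit n z)))"
        unfolding partial_blaschke_def by (rule prod.remove) (use that assms in auto)
      also have "Moebius_function 0 (radius n) (coord (prod_encode (n, j)) (orbit n z)) = ?z"
        using assms by (simp add: coord_orbit Moebius_function_compose norm_radius cmod_linf_less)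
      also have "(\<Prod>m\<in>{N..M} - {n}. - Moebius_function 0 (radius m) (coord (prod_encode (m, j)) (orbit n z))) = of_real ?c"
        unfolding of_real_prod by (rule prod.cong) (simp_all add: coord_orbit Moebius_function_of_zero radius_def)
      finally show ?thesis .
    qed
    then have "cmod (partial_blaschke N j M (orbit n z) - (- ?z)) = cmod (?z * of_real (1 - ?c))"
      by (simp add: algebra_simps)
    also have "\<dots> = cmod ?z * \<bar>1 - ?c\<bar>"
      by (simp only: norm_mult norm_of_real)
    also have "\<dots> \<le> \<bar>1 - ?c\<bar>"
      using cmod_linf_less [OF z, of j] by (simp add: mult_left_le_one_le)
    also have "\<dots> = 1 - ?c"
    proof -
      have "?c \<le> 1"
        by (rule prod_le_1) (use pw in \<open>simp del: power_Suc\<close>)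
      then show ?thesis by simp
    qed
    \<comment> \<open>Weierstrass's inequality bounds 1 minus a product by the sum of the gaps,
      which then telescopes.\<close>
    also have "\<dots> \<le> (\<Sum>m\<in>{N..M} - {n}. (1 / 2) ^ Suc m)"
      using Weierstrass_prod_ineq [of "{N..M} - {n}" "\<lambda>m. (1 / 2) ^ Suc m"] pw by (simp del: power_Suc)
    also have "\<dots> \<le> (\<Sum>m=N..M. (1 / 2) ^ Suc m)"
      by (rule sum_mono2) auto
    also have "\<dots> = (1 / 2) ^ N - (1 / 2) ^ Suc M"
    proof -
      have "N \<le> Suc M" using that assms by simp
      then show ?thesis
        using sum_Suc_diff [of N M "\<lambda>m. - ((1 / 2 :: real) ^ m)"] by (simp add: field_simps)
    qed
    finally show ?thesis
      using pw(1) [of "Suc M"] by linarith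
  qed
  then have "cmod (glim (\<lambda>M. partial_blaschke N j M (orbit n z)) - (- ?z)) \<le> (1 / 2) ^ N"
    by (intro cmod_glim_le bounded_partial_blaschke x) (auto intro: eventually_sequentiallyI [of n])
  then show ?thesis
    by (simp add: blaschke_def norm_minus_commute algebra_simps)
qed

section \<open>The map into the fiber\<close>

definition fiber_map :: "linf \<Rightarrow> (c0 \<Rightarrow> complex) \<Rightarrow> complex"
  where "fiber_map z = (\<lambda>f\<in>Hinf (ball 0 1). glim (\<lambda>n. f (orbit n z)))"

lemma fiber_map_tendsto:
  assumes "f \<in> Hinf (ball 0 1)" "z \<in> ball 0 1"
  shows "((\<lambda>n. f (orbit n z)) \<longlongrightarrow> fiber_map z f) limit_filter"
proof -
  obtain M where "\<And>x. x \<in> ball 0 1 \<Longrightarrow> cmod (f x) \<le> M"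
    using Hinf_bounded [OF assms(1)] by blast
  then have "bounded (range (\<lambda>n. f (orbit n z)))"
    using orbit_in_ball [OF assms(2)] by (auto intro!: boundedI)
  then show ?thesis
    using assms(1) glim by (simp add: fiber_map_def)
qed

lemma fiber_map_eqI:
  assumes "complex_analytic_on f (ball 0 1)" "\<And>x. x \<in> ball 0 1 \<Longrightarrow> cmod (f x) \<le> M"
    and "z \<in> ball 0 1" "((\<lambda>n. f (orbit n z)) \<longlongrightarrow> l) limit_filter"
  shows "fiber_map z (restrict f (ball 0 1)) = l"
proof -
  have "restrict f (ball 0 1) \<in> Hinf (ball 0 1)"
    using assms(1,2) by (intro HinfI) auto
  then show ?thesis
    using assms(4) orbit_in_ball [OF assms(3)] by (simp add: fiber_map_def glim_eqI)
qed

lemma Hinf_analytic: "f \<in> Hinf D \<Longrightarrow> complex_analytic_on f D"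
  by (simp add: Hinf_def)

lemma fiber_map_add:
  assumes "z \<in> ball 0 1" "f \<in> Hinf (ball 0 1)" "g \<in> Hinf (ball 0 1)"
  shows "fiber_map z (\<lambda>x\<in>ball 0 1. f x + g x) = fiber_map z f + fiber_map z g"
proof -
  obtain M M' where "\<And>x. x \<in> ball 0 1 \<Longrightarrow> cmod (f x) \<le> M" "\<And>x. x \<in> ball 0 1 \<Longrightarrow> cmod (g x) \<le> M'"
    using Hinf_bounded assms(2,3) by metis
  then have "cmod (f x + g x) \<le> M + M'" if "x \<in> ball 0 1" for x
    using that norm_triangle_le add_mono by blast
  then show ?thesis
    by (rule fiber_map_eqI [OF complex_analytic_on_add [OF Hinf_analytic [OF assms(2)] Hinf_analytic [OF assms(3)]] _ assms(1)
        tendsto_add [OF fiber_map_tendsto [OF assms(2,1)] fiber_map_tendsto [OF assms(3,1)]]])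
qed

lemma fiber_map_mult:
  assumes "z \<in> ball 0 1" "f \<in> Hinf (ball 0 1)" "g \<in> Hinf (ball 0 1)"
  shows "fiber_map z (\<lambda>x\<in>ball 0 1. f x * g x) = fiber_map z f * fiber_map z g"
proof -
  obtain M M' where M: "\<And>x. x \<in> ball 0 1 \<Longrightarrow> cmod (f x) \<le> M" "\<And>x. x \<in> ball 0 1 \<Longrightarrow> cmod (g x) \<le> M'"
    using Hinf_bounded assms(2,3) by metis
  have "cmod (f x * g x) \<le> M * M'" if "x \<in> ball 0 1" for x
    unfolding norm_mult using M [OF that] norm_ge_zero order_trans by (intro mult_mono) blast+
  then show ?thesis
    by (rule fiber_map_eqI [OF complex_analytic_on_mult [OF Hinf_analytic [OF assms(2)] Hinf_analytic [OF assms(3)]] _ assms(1)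
        tendsto_mult [OF fiber_map_tendsto [OF assms(2,1)] fiber_map_tendsto [OF assms(3,1)]]])
qed

lemma fiber_map_const:
  assumes "z \<in> ball 0 1"
  shows "fiber_map z (\<lambda>x\<in>ball 0 1. c) = c"
  by (rule fiber_map_eqI [where M = "cmod c"]) (use assms in \<open>auto intro: complex_analytic_on_const\<close>)

lemma fiber_map_in_fiber:
  assumes z: "z \<in> ball 0 1"
  shows "fiber_map z \<in> spectrum_fiber0 (ball 0 1)"
proof -
  have const: "(\<lambda>x\<in>ball 0 1. c) \<in> Hinf (ball (0 :: c0) 1)" for c
    by (rule HinfI [where M = "cmod c"]) (auto intro: complex_analytic_on_const)
  \<comment> \<open>Scaling is multiplication by a constant function, so homogeneity follows from
    multiplicativity.\<close>
  have "fiber_map z (\<lambda>x\<in>ball 0 1. c * f x) = c * fiber_map z f" if "f \<in> Hinf (ball 0 1)" for c f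
    using fiber_map_mult [OF z const that, of c] by (simp add: fiber_map_const [OF z] cong: restrict_cong)
  moreover have "\<exists>f\<in>Hinf (ball 0 1). fiber_map z f \<noteq> 0"
    using const [of 1] fiber_map_const [OF z, of 1] by force
  ultimately have "fiber_map z \<in> Hinf_spectrum (ball 0 1)"
    by (auto simp: Hinf_spectrum_def fiber_map_add [OF z] fiber_map_mult [OF z]) (simp add: fiber_map_def)
  moreover have "fiber_map z (restrict L (ball 0 1)) = 0" if L: "L \<in> complex_dual" for L
  proof -
    have bl: "bounded_linear L" "complex_linear L"
      using L by (auto simp: complex_dual_def)
    obtain K where K: "\<And>x. cmod (L x) \<le> norm x * K" "K \<ge> 0"
      using bounded_linear.nonneg_bounded [OF bl(1)] by blast
    show ?thesis
    proof (rule fiber_map_eqI [where M = K])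
      show "cmod (L x) \<le> K" if "x \<in> ball 0 1" for x
        using K(1) [of x] mult_right_mono [of "norm x" 1 K] that K(2) by simp
      show "((\<lambda>n. L (orbit n z)) \<longlongrightarrow> 0) limit_filter"
        by (rule tendsto_mono [OF limit_filter(2) orbit_weakly_null [OF L]]) (use z in simp)
    qed (rule complex_analytic_on_linear [OF bl], rule z)
  qed
  ultimately show ?thesis
    by (simp add: spectrum_fiber0_def)
qed

lemma fiber_map_le:
  assumes "f \<in> Hinf (ball 0 1)" "\<And>x. x \<in> ball 0 1 \<Longrightarrow> cmod (f x) \<le> M" "z \<in> ball 0 1"
  shows "cmod (fiber_map z f) \<le> M"
  by (rule tendsto_upperbound [OF tendsto_norm [OF fiber_map_tendsto [OF assms(1,3)]] _ limit_filter(1)])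
    (intro always_eventually allI assms(2) orbit_in_ball assms(3))

lemma complex_analytic_on_fiber_map:
  assumes "f \<in> Hinf (ball 0 1)"
  shows "complex_analytic_on (\<lambda>z. fiber_map z f) (ball 0 1)"
proof -
  obtain M where M: "\<And>x. x \<in> ball 0 1 \<Longrightarrow> cmod (f x) \<le> M"
    using Hinf_bounded [OF assms] by blast
  show ?thesis
  proof (rule complex_analytic_on_limit [OF limit_filter(1)])
    show "complex_analytic_on (\<lambda>z. f (orbit n z)) (ball 0 1)" for n
      by (rule complex_analytic_on_compose [OF complex_analytic_on_orbit Hinf_analytic [OF assms]])
        (auto simp del: mem_ball intro: orbit_in_ball)
    show "cmod (f (orbit n z)) \<le> M" if "z \<in> ball 0 1" for n z
      by (rule M [OF orbit_in_ball [OF that]])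
    show "((\<lambda>n. f (orbit n z)) \<longlongrightarrow> fiber_map z f) limit_filter" if "z \<in> ball 0 1" for z
      by (rule fiber_map_tendsto [OF assms that])
  qed simp
qed

text \<open>The test functions are \<open>k\<close> composed with \<open>blaschke N j\<close>. By
  continuity of \<open>k\<close>, their values at the images of \<open>z\<close> and
  \<open>w\<close> approach \<open>k\<close> at the \<open>j\<close>-th coordinates as
  \<open>N\<close> grows. This is the premise \<open>C\<close> of
  \<open>Hinf_polydisc_diff_le\<close>.\<close>

lemma disc_diff_le_gleason_spectrum:
  assumes z: "z \<in> ball 0 1" and w: "w \<in> ball 0 1"
    and k: "k holomorphic_on ball 0 1" "\<And>\<zeta>. \<zeta> \<in> ball 0 1 \<Longrightarrow> cmod (k \<zeta>) \<le> 1"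
  shows "cmod (k (apply_bcontfun z j) - k (apply_bcontfun w j))
    \<le> gleason_spectrum (ball 0 1) (fiber_map z) (fiber_map w)"
proof (rule field_le_epsilon)
  fix e :: real assume e: "e > 0"
  have approx: "\<exists>N0. \<forall>N\<ge>N0. cmod (fiber_map y (\<lambda>x\<in>ball 0 1. k (blaschke N j x)) - k (apply_bcontfun y j)) \<le> e / 2"
    if y: "y \<in> ball 0 1" for y
  proof -
    let ?y = "apply_bcontfun y j"
    have "isCont k ?y"
      using holomorphic_on_imp_continuous_on [OF k(1)] cmod_linf_less [of y j] y
      by (simp add: continuous_on_eq_continuous_at)
    then obtain d where d: "d > 0" "\<And>\<zeta>. cmod (\<zeta> - ?y) < d \<Longrightarrow> cmod (k \<zeta> - k ?y) < e / 2"
      unfolding isCont_def LIM_def dist_norm using e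
      by (metis diff_self half_gt_zero norm_zero)
    obtain N0 where N0: "(1 / 2 :: real) ^ N0 < d"
      using real_arch_pow_inv [OF d(1), of "1 / 2"] by auto
    have "cmod (fiber_map y (\<lambda>x\<in>ball 0 1. k (blaschke N j x)) - k ?y) \<le> e / 2" if "N \<ge> N0" for N
    proof -
      have "(1 / 2 :: real) ^ N < d"
        by (rule le_less_trans [OF power_decreasing [OF that] N0]) simp_all
      then have le: "cmod (k (blaschke N j (orbit n y)) - k ?y) \<le> e / 2" if "n \<ge> max N j" for n
        using blaschke_orbit [of y N n j] that y by (intro less_imp_le d) auto
      have b: "\<bar>cmod (k (blaschke N j (orbit n y)))\<bar> \<le> 1" for n
        using k(2) blaschke_less [OF orbit_in_ball [OF y]] by simp
      have "fiber_map y (\<lambda>x\<in>ball 0 1. k (blaschke N j x)) = glim (\<lambda>n. k (blaschke N j (orbit n y)))"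
      proof (rule fiber_map_eqI [where M = 1])
        show "complex_analytic_on (\<lambda>x. k (blaschke N j x)) (ball 0 1)"
          by (rule complex_analytic_on_compose [OF complex_analytic_on_blaschke, where V = "ball 0 1"])
            (use k(1) blaschke_less in \<open>auto simp: complex_analytic_on_iff_holomorphic\<close>)
        show "cmod (k (blaschke N j x)) \<le> 1" if "x \<in> ball 0 1" for x
          using k(2) blaschke_less [OF that] by simp
        show "((\<lambda>n. k (blaschke N j (orbit n y))) \<longlongrightarrow> glim (\<lambda>n. k (blaschke N j (orbit n y)))) limit_filter"
          by (rule glim) (use b in \<open>auto intro!: boundedI\<close>)
      qed (rule y)
      also have "cmod (\<dots> - k ?y) \<le> e / 2"
        by (rule cmod_glim_le) (use b le in \<open>auto intro!: boundedI eventually_sequentiallyI [of "max N j"]\<close>)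
      finally show ?thesis .
    qed
    then show ?thesis by blast
  qed
  \<comment> \<open>The threshold depends on the point; the larger of the two gives one test
    function good for both.\<close>
  obtain N where Nz: "cmod (fiber_map z (\<lambda>x\<in>ball 0 1. k (blaschke N j x)) - k (apply_bcontfun z j)) \<le> e / 2"
    and Nw: "cmod (fiber_map w (\<lambda>x\<in>ball 0 1. k (blaschke N j x)) - k (apply_bcontfun w j)) \<le> e / 2"
    using approx [OF z] approx [OF w] by (meson max.cobounded1 max.cobounded2)
  have "cmod (fiber_map z (\<lambda>x\<in>ball 0 1. k (blaschke N j x)) - fiber_map w (\<lambda>x\<in>ball 0 1. k (blaschke N j x)))
    \<le> gleason_spectrum (ball 0 1) (fiber_map z) (fiber_map w)"
  proof (rule gleason_spectrum_ge [where C = 2])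
    show "cmod (fiber_map z f - fiber_map w f) \<le> 2"
      if "f \<in> Hinf (ball 0 1)" "\<And>x. x \<in> ball 0 1 \<Longrightarrow> cmod (f x) \<le> 1" for f
      using fiber_map_le [OF that z] fiber_map_le [OF that w] norm_triangle_ineq4 [of "fiber_map z f" "fiber_map w f"]
      by linarith
    show "complex_analytic_on (\<lambda>x. k (blaschke N j x)) (ball 0 1)"
      by (rule complex_analytic_on_compose [OF complex_analytic_on_blaschke, where V = "ball 0 1"])
        (use k(1) blaschke_less in \<open>auto simp: complex_analytic_on_iff_holomorphic\<close>)
    show "cmod (k (blaschke N j x)) \<le> 1" if "x \<in> ball 0 1" for x
      using k(2) blaschke_less [OF that] by simp
  qed auto
  with Nz Nw show "cmod (k (apply_bcontfun z j) - k (apply_bcontfun w j))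
      \<le> gleason_spectrum (ball 0 1) (fiber_map z) (fiber_map w) + e"
    by (smt (verit) norm_triangle_ineq4 norm_minus_commute diff_diff_eq2 diff_add_cancel norm_triangle_ineq field_sum_of_halves)
qed

lemma gleason_spectrum_fiber_map:
  assumes z: "z \<in> ball 0 1" and w: "w \<in> ball 0 1"
  shows "gleason_spectrum (ball 0 1) (fiber_map z) (fiber_map w) = gleason_domain (ball 0 1) z w"
proof (rule antisym)
  show "gleason_spectrum (ball 0 1) (fiber_map z) (fiber_map w) \<le> gleason_domain (ball 0 1) z w"
  proof (rule gleason_spectrum_le)
    fix f :: "c0 \<Rightarrow> complex"
    assume f: "complex_analytic_on f (ball 0 1)" "\<And>x. x \<in> ball 0 1 \<Longrightarrow> cmod (f x) \<le> 1" "f \<in> extensional (ball 0 1)"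
    then have Hinf: "f \<in> Hinf (ball 0 1)"
      by (auto simp: Hinf_def bounded_iff intro!: exI [of _ 1])
    \<comment> \<open>The function \<open>z \<mapsto> fiber_map z f\<close> lies in the unit ball of
      bounded analytic functions on the ball of bounded sequences, so it competes in the supremum on
      the right.\<close>
    have "cmod ((\<lambda>z\<in>ball 0 1. fiber_map z f) z - (\<lambda>z\<in>ball 0 1. fiber_map z f) w)
        \<le> gleason_domain (ball 0 1) z w"
      unfolding gleason_domain_eq
    proof (rule gleason_spectrum_ge [where C = 2])
      show "cmod (g z - g w) \<le> 2" if "\<And>x. x \<in> ball 0 1 \<Longrightarrow> cmod (g x) \<le> 1" for g
        using that [OF z] that [OF w] norm_triangle_ineq4 [of "g z" "g w"] by linarith
    qed (use complex_analytic_on_fiber_map [OF Hinf] fiber_map_le [OF Hinf f(2)] in auto)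
    then show "cmod (fiber_map z f - fiber_map w f) \<le> gleason_domain (ball 0 1) z w"
      using z w by simp
  qed auto
  show "gleason_domain (ball 0 1) z w \<le> gleason_spectrum (ball 0 1) (fiber_map z) (fiber_map w)"
    unfolding gleason_domain_eq
  proof (rule gleason_spectrum_le)
    fix g :: "linf \<Rightarrow> complex"
    assume g: "complex_analytic_on g (ball 0 1)" "\<And>x. x \<in> ball 0 1 \<Longrightarrow> cmod (g x) \<le> 1"
    show "cmod (g z - g w) \<le> gleason_spectrum (ball 0 1) (fiber_map z) (fiber_map w)"
    proof (rule Hinf_polydisc_diff_le [OF _ _ g])
      show "norm z < 1" "norm w < 1"
        using z w by simp_all
    qed (assumption, rule disc_diff_le_gleason_spectrum [OF z w])
  qed auto
qed

text \<open>Taking the identity for \<open>k\<close> in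
  \<open>disc_diff_le_gleason_spectrum\<close>, distance 0 forces all coordinates to agree.\<close>

lemma inj_on_fiber_map: "inj_on fiber_map (ball 0 1)"
proof
  fix z w :: linf assume zw: "z \<in> ball 0 1" "w \<in> ball 0 1" and eq: "fiber_map z = fiber_map w"
  have "gleason_spectrum (ball 0 1) (fiber_map z) (fiber_map w) \<le> 0"
    by (rule gleason_spectrum_le) (auto simp: eq)
  then have "cmod (apply_bcontfun z j - apply_bcontfun w j) \<le> 0" for j
    by (rule order_trans [OF disc_diff_le_gleason_spectrum [OF zw, of "\<lambda>\<zeta>. \<zeta>" j], rotated 2])
      (auto intro: holomorphic_on_ident)
  then have "apply_bcontfun z j = apply_bcontfun w j" for j
    by simp
  then show "z = w"
    by (rule bcontfun_eqI)
qed

theorem theorem6p6: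
  fixes B :: "c0 set" and B2 :: "linf set"
  defines "B \<equiv> ball 0 1" and "B2 \<equiv> ball 0 1"
  shows "\<exists>S :: linf \<Rightarrow> (c0 \<Rightarrow> complex) \<Rightarrow> complex.
    S \<in> B2 \<rightarrow> spectrum_fiber0 B \<and>
    analytic_into_spectrum B2 B S \<and>
    inj_on S B2 \<and>
    (\<forall>z\<in>B2. \<forall>w\<in>B2. gleason_spectrum B (S z) (S w) = gleason_domain B2 z w)"
  unfolding B_def B2_def analytic_into_spectrum_def
  by (intro exI [of _ fiber_map] conjI funcsetI ballI fiber_map_in_fiber complex_analytic_on_fiber_map
      inj_on_fiber_map gleason_spectrum_fiber_map)

end
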